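(* Let $\phi$ be a Drinfeld module of rank $r$ over $\mathbb{C}_\infty$ given by $\phi_T=\sum_{i=0}^r A_i\tau^i$ with $A_0=T$, $A_i\in\mathbb{C}_\infty$, $A_r\neq0$. For $n\geq0$ define \[\alpha_n:=\sum_{\mathbf{S}\in P_r(n)}\frac{\mathbf{A}^{\mathbf{S}}}{D_n(\bigcup\mathbf{S})}.\] Then the series $\sum_{n=0}^\infty\alpha_n z^{q^n}$ converges for all $z\in\mathbb{C}_\infty$, and it is the unique series of the form $e(z)=\sum_{n\ge0}\alpha_n z^{q^n}$ with $\alpha_0=1$ satisfying the functional equation $e(Tz)=\phi_T(e(z))$ (i.e. $e(Tz)=Te(z)+\sum_{i=1}^rA_ie(z)^{q^i}$). Consequently the exponential function of $\phi$ is $e_\phi(z)=\sum_{n=0}^\infty\alpha_nz^{q^n}$.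
   Context: Let $q$ be a power of a prime, $\mathbb{A}=\mathbb{F}_q[T]$, with valuation $v$ on $\mathbb{F}_q(T)$ determined by $v(T)=-1$; $\mathbb{C}_\infty$ is the completion of an algebraic closure of the completion of $\mathbb{F}_q(T)$ with respect to $v$, and $v$ is extended to $\mathbb{C}_\infty$. $\tau$ denotes the $q$-th power Frobenius, and $\mathbb{C}_\infty\{\tau\}$ the twisted polynomial ring with $\tau\ell=\ell^q\tau$; a Drinfeld module of rank $r$ is an $\mathbb{F}_q$-linear ring homomorphism $\phi:\mathbb{A}\to\mathbb{C}_\infty\{\tau\}$ with $\phi_T=T+\sum_{i=1}^rA_i\tau^i$, $A_r\ne0$; $\phi_T$ acts on $\mathbb{C}_\infty$ by $\phi_T(x)=Tx+\sum A_ix^{q^i}$. Its exponential $e_\phi$ is the entire $\mathbb{F}_q$-linear function $e_\phi(z)=z+\sum_{n\ge1}\alpha_nz^{q^n}$ with $e_\phi(Tz)=\phi_T(e_\phi(z))$. Notation: $[n]:=T^{q^n}-T$. For $S\subset\{0,\dots,n-1\}$, $D_n(S):=\prod_{i\in S}[n-i]^{q^i}$ (empty product $=1$). For a finite $S\subset\mathbb{N}$, $w(S):=\sum_{i\in S}q^i$. Shadowed partitions: for $S\subset\mathbb{Z}$, $S+j:=\{s+j:s\in S\}$; for $n>0$, $P_r(n)$ is the set of $r$-tuples $\mathbf{S}=(S_1,\dots,S_r)$ of subsets of $\{0,\dots,n-1\}$ such that the sets $S_i+j$ ($1\le i\le r$, $0\le j\le i-1$) form a partition of $\{0,\dots,n-1\}$;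 $P_r(0)$ consists of the single tuple of empty sets. For $\mathbf{S}\in P_r(n)$, $\bigcup\mathbf{S}:=\bigcup_iS_i$ and $\mathbf{A}^{\mathbf{S}}:=\prod_{i=1}^rA_i^{w(S_i)}$. *)

theory Defs
  imports "HOL-Analysis.Elementary_Topology" "HOL-Library.Extended_Real" "HOL-Library.Disjoint_Sets"
    "HOL-Library.FuncSet" "HOL-Library.Cardinality"
    "HOL-Computational_Algebra.Polynomial" "HOL-Computational_Algebra.Formal_Power_Series"
begin

section \<open>The field of constants, the rational function field and its completions\<close>

text \<open>
  The finite field with \<open>q\<close> elements is a finite field type \<open>'k\<close>, so that \<open>q\<close> is \<open>CARD('k)\<close> and
  the polynomial ring \<open>\<bbbA>\<close> is \<open>'k poly\<close>, with indeterminate \<open>[:0, 1:]\<close>.  A field \<open>'a\<close> containing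
  the rational functions over \<open>'k\<close> is given together with the embedding \<open>\<iota>\<close> of the constants
  and the image \<open>T\<close> of the indeterminate.
\<close>

definition rational_functions :: "('k::field \<Rightarrow> 'a::field) \<Rightarrow> 'a \<Rightarrow> 'a set" where
  "rational_functions \<iota> T =
     {poly (map_poly \<iota> f) T / poly (map_poly \<iota> g) T | f g. g \<noteq> 0}"

definition algebraic_over :: "'a::field set \<Rightarrow> 'a set" where
  "algebraic_over K = {x. \<exists>p. p \<noteq> 0 \<and> (\<forall>i. coeff p i \<in> K) \<and> poly p x = 0}"

text \<open>
  The field \<open>\<complex>\<^sub>\<infinity>\<close>, described up to isomorphism of valued fields.  The sort \<open>complete_space\<close>
  supplies completeness, for the metric attached to \<open>v\<close>.  Since the whole field is complete, the
  completion of the rational functions is their closure \<open>K\<close>; the elements algebraic over \<open>K\<close> form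
  an algebraic closure of \<open>K\<close>, and they are dense, so that the whole field is their completion.
  The elements \<open>\<iota> c\<close> with \<open>c \<noteq> 0\<close> are roots of unity, so \<open>v\<close> vanishes on them; hence the
  condition \<open>v T = -1\<close> determines \<open>v\<close> on the rational functions.
\<close>

locale C_infinity =
  fixes \<iota> :: "'k::{field,finite} \<Rightarrow> 'a::{field,complete_space}"
    and T :: 'a
    and v :: "'a \<Rightarrow> ereal"
  assumes const_add: "\<iota> (c + d) = \<iota> c + \<iota> d"
    and const_mult: "\<iota> (c * d) = \<iota> c * \<iota> d"
    and const_one: "\<iota> 1 = 1"
    and v_infinity_iff: "v x = \<infinity> \<longleftrightarrow> x = 0"
    and v_not_minus_infinity: "v x \<noteq> - \<infinity>"
    and v_mult: "v (x * y) = v x + v y"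
    and v_add: "min (v x) (v y) \<le> v (x + y)"
    and v_T: "v T = - 1"
    and dist_v: "dist x y =
      (if x = y then 0 else real CARD('k) powr (- real_of_ereal (v (x - y))))"
    and algebraic_closure:
      "\<lbrakk>0 < degree p; \<forall>i. coeff p i \<in> algebraic_over (closure (rational_functions \<iota> T))\<rbrakk> \<Longrightarrow>
        \<exists>x \<in> algebraic_over (closure (rational_functions \<iota> T)). poly p x = 0"
    and algebraic_dense:
      "closure (algebraic_over (closure (rational_functions \<iota> T))) = UNIV"

section \<open>Twisted polynomials, Drinfeld modules and their exponentials\<close>

text \<open>
  The twisted polynomial \<open>\<Sum>\<^sub>i a\<^sub>i \<tau>\<^sup>i\<close> is represented by the element of \<open>'a poly\<close> with the same
  coefficients: zero, one, addition and left multiplication by scalars are those of \<open>'a poly\<close>,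
  but the product is \<open>twisted_mult\<close>, as prescribed by \<open>\<tau> l = l\<^sup>q \<tau>\<close>.
\<close>

definition twisted_mult :: "nat \<Rightarrow> 'a::field poly \<Rightarrow> 'a poly \<Rightarrow> 'a poly" where
  "twisted_mult q f g =
     (\<Sum>i\<le>degree f. \<Sum>j\<le>degree g. monom (coeff f i * coeff g j ^ (q ^ i)) (i + j))"

definition twisted_eval :: "nat \<Rightarrow> 'a::field poly \<Rightarrow> 'a \<Rightarrow> 'a" where
  "twisted_eval q f x = (\<Sum>i\<le>degree f. coeff f i * x ^ (q ^ i))"

locale drinfeld_module = C_infinity \<iota> T v
  for \<iota> :: "'k::{field,finite} \<Rightarrow> 'a::{field,complete_space}" and T v +
  fixes r :: nat
    and \<phi> :: "'k poly \<Rightarrow> 'a poly"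
  assumes phi_add: "\<phi> (a + b) = \<phi> a + \<phi> b"
    and phi_mult: "\<phi> (a * b) = twisted_mult CARD('k) (\<phi> a) (\<phi> b)"
    and phi_one: "\<phi> 1 = 1"
    and phi_smult: "\<phi> (smult c a) = smult (\<iota> c) (\<phi> a)"
    and rank_pos: "1 \<le> r"
    and phi_T_degree: "degree (\<phi> [:0, 1:]) = r"
    and phi_T_coeff_0: "coeff (\<phi> [:0, 1:]) 0 = T"

definition is_exponential ::
  "('k::{field,finite} \<Rightarrow> 'a::{field,complete_space}) \<Rightarrow> 'a \<Rightarrow> ('k poly \<Rightarrow> 'a poly) \<Rightarrow> ('a \<Rightarrow> 'a) \<Rightarrow> bool"
  where
  "is_exponential \<iota> T \<phi> e \<longleftrightarrow>
     (\<forall>x y. e (x + y) = e x + e y) \<and>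
     (\<forall>c x. e (\<iota> c * x) = \<iota> c * e x) \<and>
     (\<exists>a. a 0 = 1 \<and> (\<forall>z. (\<lambda>n. a n * z ^ (CARD('k) ^ n)) sums e z)) \<and>
     (\<forall>z. e (T * z) = twisted_eval CARD('k) (\<phi> [:0, 1:]) (e z))"

definition exponential ::
  "('k::{field,finite} \<Rightarrow> 'a::{field,complete_space}) \<Rightarrow> 'a \<Rightarrow> ('k poly \<Rightarrow> 'a poly) \<Rightarrow> 'a \<Rightarrow> 'a"
  where
  "exponential \<iota> T \<phi> = (THE e. is_exponential \<iota> T \<phi> e)"

section \<open>Formal version of the functional equation\<close>

text \<open>
  The formal series \<open>\<Sum>\<^sub>n \<beta>\<^sub>n X\<^bsup>q\<^sup>n\<^esup>\<close>; the index set of the inner sum has at most one element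
  if \<open>q \<ge> 2\<close>.
\<close>

definition q_series :: "nat \<Rightarrow> (nat \<Rightarrow> 'a::field) \<Rightarrow> 'a fps" where
  "q_series q \<beta> = Abs_fps (\<lambda>m. \<Sum>n | q ^ n = m. \<beta> n)"

definition twisted_eval_fps :: "nat \<Rightarrow> 'a::field poly \<Rightarrow> 'a fps \<Rightarrow> 'a fps" where
  "twisted_eval_fps q f F = (\<Sum>i\<le>degree f. fps_const (coeff f i) * F ^ (q ^ i))"

section \<open>Shadowed partitions\<close>

definition bracket :: "nat \<Rightarrow> 'a::field \<Rightarrow> nat \<Rightarrow> 'a" where
  "bracket q T n = T ^ (q ^ n) - T"

definition D_prod :: "nat \<Rightarrow> 'a::field \<Rightarrow> nat \<Rightarrow> nat set \<Rightarrow> 'a" where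
  "D_prod q T n S = (\<Prod>i\<in>S. bracket q T (n - i) ^ (q ^ i))"

definition weight :: "nat \<Rightarrow> nat set \<Rightarrow> nat" where
  "weight q S = (\<Sum>i\<in>S. q ^ i)"

text \<open>
  An \<open>r\<close>-tuple is an extensional function on \<open>{1..r}\<close>.  The parts of the partition are
  an indexed family and may be empty, so \<open>partition_on\<close> does not apply.  For \<open>n = 0\<close> all
  components are empty, hence there is exactly one tuple.
\<close>

definition shadowed_partitions :: "nat \<Rightarrow> nat \<Rightarrow> (nat \<Rightarrow> nat set) set" where
  "shadowed_partitions r n =
     {S \<in> {1..r} \<rightarrow>\<^sub>E Pow {..<n}.
        disjoint_family_on (\<lambda>(i, j). (\<lambda>s. s + j) ` S i) (SIGMA i:{1..r}. {..<i}) \<and>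
        (\<Union>(i, j)\<in>(SIGMA i:{1..r}. {..<i}). (\<lambda>s. s + j) ` S i) = {..<n}}"

definition tuple_power :: "nat \<Rightarrow> nat \<Rightarrow> (nat \<Rightarrow> 'a::field) \<Rightarrow> (nat \<Rightarrow> nat set) \<Rightarrow> 'a" where
  "tuple_power q r A S = (\<Prod>i=1..r. A i ^ weight q (S i))"

end

theory Submission imports Defs
begin

text \<open>
  Comparing coefficients, the functional equation amounts to
  \<open>[n] \<alpha>\<^sub>n = \<Sum>\<^sub>i A\<^sub>i \<alpha>\<^bsub>n-i\<^esub>\<^bsup>q\<^sup>i\<^esup>\<close>, summed over \<open>1 \<le> i \<le> min r n\<close>, which has exactly one solution with
  \<open>\<alpha>\<^sub>0 = 1\<close> because \<open>[n] \<noteq> 0\<close>.  The sum over shadowed partitions satisfies it: in a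
  shadowed partition of \<open>{0..<n}\<close> the point \<open>0\<close> lies in exactly one \<open>S\<^sub>i\<close>, and removing it and
  shifting everything down by \<open>i\<close> leaves an arbitrary shadowed partition of \<open>{0..<n-i}\<close>.
  Since \<open>\<bar>[n]\<bar> = q\<^bsup>q\<^sup>n\<^esup>\<close>, the recursion also shows that \<open>\<bar>\<alpha>\<^sub>n\<bar> R\<^bsup>q\<^sup>n\<^esup>\<close> tends to \<open>0\<close> for every \<open>R\<close>.
\<close>

section \<open>Frobenius\<close>

text \<open>
  The library fact \<open>finite_field_power_card_eq_same\<close> is stated for the class \<open>finite_field\<close>,
  which the sort \<open>{field,finite}\<close> does not imply for the type checker.
\<close>

lemma finite_field_power_card:
  fixes x :: "'k::{field,finite}"
  shows "x ^ CARD('k) = x"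
proof (cases "x = 0")
  case True
  then show ?thesis by (simp add: zero_less_card_finite)
next
  case False
  have "bij_betw ((*) x) (UNIV - {0}) (UNIV - {0})"
    by (rule bij_betw_byWitness[where f' = "\<lambda>y. y / x"]) (use False in auto)
  then have "(\<Prod>y\<in>UNIV - {0}. x * y) = \<Prod>(UNIV - {0::'k})"
    by (rule prod.reindex_bij_betw)
  then have "x ^ (CARD('k) - 1) = 1"
    by (simp add: prod.distrib card_Diff_singleton)
  then show ?thesis
    by (metis Suc_diff_1 mult.right_neutral power_Suc zero_less_card_finite)
qed

lemma card_field_gt_1: "1 < CARD('k::{field,finite})"
proof -
  have "card {0, 1 :: 'k} \<le> CARD('k)"
    by (intro card_mono) auto
  then show ?thesis by simp
qed

text \<open>
  The polynomial \<open>(X + 1)\<^sup>q - X\<^sup>q - 1\<close> has degree less than \<open>q\<close> and vanishes at all \<open>q\<close> elements.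
\<close>

lemma binomial_card_eq_0:
  assumes "0 < i" "i < CARD('k)"
  shows "of_nat (CARD('k::{field,finite}) choose i) = (0 :: 'k)"
proof -
  let ?q = "CARD('k)"
  define p :: "'k poly" where "p = (\<Sum>i\<in>{0<..<?q}. monom (of_nat (?q choose i)) i)"
  have "poly p x = 0" for x
  proof -
    have "(x + 1) ^ ?q = (\<Sum>i\<le>?q. of_nat (?q choose i) * x ^ i)"
      using binomial_ring[of x 1 ?q] by simp
    also have "{..?q} = insert 0 (insert ?q {0<..<?q})" by auto
    also have "(\<Sum>i\<in>\<dots>. of_nat (?q choose i) * x ^ i) = 1 + (x ^ ?q + poly p x)"
      using card_field_gt_1[where 'k='k] by (simp add: p_def poly_sum poly_monom)
    finally show ?thesis by (simp add: finite_field_power_card)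
  qed
  moreover have "degree p < ?q"
    unfolding p_def using assms
    by (intro degree_sum_less) (auto intro: le_less_trans[OF degree_monom_le])
  ultimately have "p = 0"
    using card_poly_roots_bound[of p] by fastforce
  then have "coeff p i = 0" by simp
  then show ?thesis
    using assms by (simp add: p_def coeff_sum)
qed

text \<open>Only the two outer terms of the binomial expansion survive. A general commutative ring
  is taken since the fact serves both in \<open>'a\<close> and in \<open>'a fps\<close>.\<close>

lemma binomial_power_add:
  fixes x y :: "'b::comm_ring_1"
  assumes "0 < q" and "\<And>i. 0 < i \<Longrightarrow> i < q \<Longrightarrow> of_nat (q choose i) = (0 :: 'b)"
  shows "(x + y) ^ q = x ^ q + y ^ q"
proof -
  have "(x + y) ^ q = (\<Sum>i\<le>q. of_nat (q choose i) * x ^ i * y ^ (q - i))"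
    by (rule binomial_ring)
  also have "\<dots> = (\<Sum>i\<in>{0, q}. of_nat (q choose i) * x ^ i * y ^ (q - i))"
    using assms by (intro sum.mono_neutral_right) auto
  finally show ?thesis using \<open>0 < q\<close> by simp
qed

lemma additive_power_iterate:
  fixes x y :: "'b::comm_semiring_1"
  assumes "\<And>x y :: 'b. (x + y) ^ q = x ^ q + y ^ q"
  shows "(x + y) ^ (q ^ n) = x ^ (q ^ n) + y ^ (q ^ n)"
  by (induction n) (simp_all add: assms power_mult mult.commute[of q])

lemma additive_power_sum:
  fixes f :: "'c \<Rightarrow> 'b::comm_semiring_1"
  assumes "0 < m" "\<And>x y :: 'b. (x + y) ^ m = x ^ m + y ^ m"
  shows "sum f X ^ m = (\<Sum>x\<in>X. f x ^ m)"
  using assms by (induction X rule: infinite_finite_induct) (auto simp: zero_power)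

section \<open>The recursion for shadowed partitions\<close>

text \<open>
  The shadows of an element \<open>s\<close> of \<open>S i\<close> fill the interval \<open>{s..<s + i}\<close>, so that a shadowed
  partition is a tiling of \<open>{..<n}\<close> by intervals, those of length \<open>i\<close> starting at the elements
  of \<open>S i\<close>.
\<close>

lemma shadowed_partitions_iff:
  "S \<in> shadowed_partitions r n \<longleftrightarrow>
     S \<in> extensional {1..r} \<and>
     (\<forall>i\<in>{1..r}. \<forall>s\<in>S i. s + i \<le> n) \<and>
     (\<forall>m<n. \<exists>i\<in>{1..r}. \<exists>s\<in>S i. s \<le> m \<and> m < s + i) \<and>
     (\<forall>i\<in>{1..r}. \<forall>s\<in>S i. \<forall>i'\<in>{1..r}. \<forall>s'\<in>S i'. \<forall>m.
        s \<le> m \<and> m < s + i \<and> s' \<le> m \<and> m < s' + i' \<longrightarrow> i = i' \<and> s = s')"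
  (is "?L \<longleftrightarrow> ?E \<and> ?B \<and> ?C \<and> ?D")
proof
  assume L: ?L
  have sub: "\<And>i. i \<in> {1..r} \<Longrightarrow> S i \<subseteq> {..<n}" and E: ?E
    and dis: "disjoint_family_on (\<lambda>(i, j). (\<lambda>s. s + j) ` S i) (SIGMA i:{1..r}. {..<i})"
    and un: "(\<Union>(i, j)\<in>(SIGMA i:{1..r}. {..<i}). (\<lambda>s. s + j) ` S i) = {..<n}"
    using L unfolding shadowed_partitions_def PiE_def by auto
  have B: ?B
  proof (intro ballI)
    fix i s assume "i \<in> {1..r}" "s \<in> S i"
    then have "s + (i - 1) \<in> (\<Union>(i, j)\<in>(SIGMA i:{1..r}. {..<i}). (\<lambda>s. s + j) ` S i)"
      by (intro UN_I[of "(i, i - 1)"]) auto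
    then show "s + i \<le> n" unfolding un using \<open>i \<in> {1..r}\<close> by auto
  qed
  have C: ?C
  proof (intro allI impI)
    fix m assume "m < n"
    then have "m \<in> (\<Union>(i, j)\<in>(SIGMA i:{1..r}. {..<i}). (\<lambda>s. s + j) ` S i)" using un by simp
    then obtain i j s where "i \<in> {1..r}" "j < i" "s \<in> S i" "m = s + j" by auto
    then show "\<exists>i\<in>{1..r}. \<exists>s\<in>S i. s \<le> m \<and> m < s + i"
      by (intro bexI[of _ i] bexI[of _ s]) auto
  qed
  have D: ?D
  proof (intro ballI allI impI)
    fix i s i' s' m
    assume *: "i \<in> {1..r}" "s \<in> S i" "i' \<in> {1..r}" "s' \<in> S i'"
      "s \<le> m \<and> m < s + i \<and> s' \<le> m \<and> m < s' + i'"
    \<comment> \<open>The point \<open>m\<close> is the shadow of \<open>s\<close> at distance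
      \<open>m - s\<close> and of \<open>s'\<close> at distance \<open>m - s'\<close>, so
      disjointness forces the two index pairs to agree.\<close>
    have "m \<in> (\<lambda>t. t + (m - s)) ` S i \<inter> (\<lambda>t. t + (m - s')) ` S i'"
      using * image_eqI[of m "\<lambda>t. t + (m - s)" s "S i"]
        image_eqI[of m "\<lambda>t. t + (m - s')" s' "S i'"] by simp
    moreover have "(\<lambda>t. t + (m - s)) ` S i \<inter> (\<lambda>t. t + (m - s')) ` S i' = {}"
      if "(i, m - s) \<noteq> (i', m - s')"
    proof -
      have "(i, m - s) \<in> (SIGMA i:{1..r}. {..<i})" "(i', m - s') \<in> (SIGMA i:{1..r}. {..<i})"
        using * by auto
      from disjoint_family_onD[OF dis this that] show ?thesis by simp
    qed
    ultimately have "(i, m - s) = (i', m - s')" by blast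
    then show "i = i' \<and> s = s'" using * by auto
  qed
  from E B C D show "?E \<and> ?B \<and> ?C \<and> ?D" by blast
next
  assume R: "?E \<and> ?B \<and> ?C \<and> ?D"
  then have E: ?E and B: ?B and C: ?C and D: ?D by blast+
  have "disjoint_family_on (\<lambda>(i, j). (\<lambda>s. s + j) ` S i) (SIGMA i:{1..r}. {..<i})"
    unfolding disjoint_family_on_def
  proof (intro ballI impI)
    fix x y
    assume xy: "x \<in> (SIGMA i:{1..r}. {..<i})" "y \<in> (SIGMA i:{1..r}. {..<i})" "x \<noteq> y"
    obtain i j i' j' where [simp]: "x = (i, j)" "y = (i', j')" by (cases x, cases y)
    have *: "i \<in> {1..r}" "j < i" "i' \<in> {1..r}" "j' < i'" "(i, j) \<noteq> (i', j')"
      using xy by auto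
    have False if "s \<in> S i" "s' \<in> S i'" "s + j = s' + j'" for s s'
      using D[rule_format, of i s i' s' "s + j"] * that by auto
    then show "(case x of (i, j) \<Rightarrow> (\<lambda>s. s + j) ` S i) \<inter> (case y of (i, j) \<Rightarrow> (\<lambda>s. s + j) ` S i) = {}"
      by auto
  qed
  moreover have "(\<Union>(i, j)\<in>(SIGMA i:{1..r}. {..<i}). (\<lambda>s. s + j) ` S i) = {..<n}"
  proof (intro set_eqI iffI)
    fix m assume "m \<in> {..<n}"
    then obtain i s where "i \<in> {1..r}" "s \<in> S i" "s \<le> m" "m < s + i" using C by blast
    then show "m \<in> (\<Union>(i, j)\<in>(SIGMA i:{1..r}. {..<i}). (\<lambda>s. s + j) ` S i)"
      by (intro UN_I[of "(i, m - s)"]) (auto intro: image_eqI[of _ _ s])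
  next
    fix m assume "m \<in> (\<Union>(i, j)\<in>(SIGMA i:{1..r}. {..<i}). (\<lambda>s. s + j) ` S i)"
    then obtain i j s where "i \<in> {1..r}" "j < i" "s \<in> S i" "m = s + j" by auto
    then show "m \<in> {..<n}" using B by force
  qed
  moreover have "S i \<subseteq> {..<n}" if "i \<in> {1..r}" for i
    using B that by force
  then have "S \<in> {1..r} \<rightarrow>\<^sub>E Pow {..<n}"
    using E by (simp add: PiE_def Pi_def)
  ultimately show ?L unfolding shadowed_partitions_def by blast
qed

text \<open>The inverse of removing the first tile: a tile of length \<open>i\<close> is put in
  front of a tiling moved up by \<open>i\<close>. The restriction to \<open>{1..r}\<close> keeps the
  tuple extensional.\<close>

definition prepend_part :: "nat \<Rightarrow> nat \<Rightarrow> (nat \<Rightarrow> nat set) \<Rightarrow> nat \<Rightarrow> nat set" where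
  "prepend_part r i S =
     (\<lambda>k\<in>{1..r}. (if k = i then {0} else {}) \<union> (\<lambda>s. s + i) ` S k)"

text \<open>The new tile fills \<open>{..<i}\<close> and the moved tiles fill
  \<open>{i..<n}\<close>, so they leave no gap and do not overlap.\<close>

lemma prepend_part_in:
  assumes S: "S \<in> shadowed_partitions r (n - i)" and i: "i \<in> {1..r}" "i \<le> n"
  shows "prepend_part r i S \<in> shadowed_partitions r n"
proof -
  have B: "\<And>k s. k \<in> {1..r} \<Longrightarrow> s \<in> S k \<Longrightarrow> s + k \<le> n - i"
    and C: "\<And>m. m < n - i \<Longrightarrow> \<exists>k\<in>{1..r}. \<exists>s\<in>S k. s \<le> m \<and> m < s + k"
    and D: "\<And>k s k' s' m. \<lbrakk>k \<in> {1..r}; s \<in> S k; k' \<in> {1..r}; s' \<in> S k';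
         s \<le> m; m < s + k; s' \<le> m; m < s' + k'\<rbrakk> \<Longrightarrow> k = k' \<and> s = s'"
    using S unfolding shadowed_partitions_iff by blast+
  have mem: "s \<in> prepend_part r i S k \<longleftrightarrow> (s = 0 \<and> k = i) \<or> (i \<le> s \<and> s - i \<in> S k)"
    if "k \<in> {1..r}" for k s
    using that by (force simp: prepend_part_def intro: image_eqI[of _ _ "s - i"])
  show ?thesis unfolding shadowed_partitions_iff
  proof (intro conjI ballI allI impI)
    show "prepend_part r i S \<in> extensional {1..r}" by (simp add: prepend_part_def)
  next
    fix k s assume "k \<in> {1..r}" "s \<in> prepend_part r i S k"
    then show "s + k \<le> n" using B[of k "s - i"] i mem by auto
  next
    fix m assume "m < n"
    show "\<exists>k\<in>{1..r}. \<exists>s\<in>prepend_part r i S k. s \<le> m \<and> m < s + k"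
    proof (cases "m < i")
      case True
      then show ?thesis using i mem by (intro bexI[of _ i] bexI[of _ 0]) auto
    next
      case False
      then obtain k s where "k \<in> {1..r}" "s \<in> S k" "s \<le> m - i" "m - i < s + k"
        using C[OF diff_less_mono[OF \<open>m < n\<close>, of i]] by auto
      then show ?thesis using False mem by (intro bexI[of _ k] bexI[of _ "s + i"]) auto
    qed
  next
    fix k s k' s' m
    assume *: "k \<in> {1..r}" "s \<in> prepend_part r i S k" "k' \<in> {1..r}" "s' \<in> prepend_part r i S k'"
      "s \<le> m \<and> m < s + k \<and> s' \<le> m \<and> m < s' + k'"
    have "(s = 0 \<and> k = i) \<or> (i \<le> s \<and> s - i \<in> S k)"
      "(s' = 0 \<and> k' = i) \<or> (i \<le> s' \<and> s' - i \<in> S k')"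
      using * mem by blast+
    \<comment> \<open>In the mixed case one tile stops before \<open>i\<close> and the other starts
      at or after \<open>i\<close>, so they cannot share \<open>m\<close>.\<close>
    then have "(k = k' \<and> s = s')"
      using * D[of k "s - i" k' "s' - i" "m - i"] by force
    then show "k = k'" "s = s'" by auto
  qed
qed

text \<open>The tile covering the point 0 can only start there; its length is the wanted
  \<open>i\<close>, and all other tiles start at \<open>i\<close> or later.\<close>

lemma shadowed_partitions_cases:
  assumes S: "S \<in> shadowed_partitions r n" and n: "0 < n"
  obtains i S' where "i \<in> {1..r}" "i \<le> n" "S' \<in> shadowed_partitions r (n - i)"
    "S = prepend_part r i S'"
proof -
  have E: "S \<in> extensional {1..r}"
    and B: "\<And>k s. k \<in> {1..r} \<Longrightarrow> s \<in> S k \<Longrightarrow> s + k \<le> n"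
    and C: "\<And>m. m < n \<Longrightarrow> \<exists>k\<in>{1..r}. \<exists>s\<in>S k. s \<le> m \<and> m < s + k"
    and D: "\<And>k s k' s' m. \<lbrakk>k \<in> {1..r}; s \<in> S k; k' \<in> {1..r}; s' \<in> S k';
         s \<le> m; m < s + k; s' \<le> m; m < s' + k'\<rbrakk> \<Longrightarrow> k = k' \<and> s = s'"
    using S unfolding shadowed_partitions_iff by blast+
  from C[OF n] obtain i where i: "i \<in> {1..r}" "0 \<in> S i" by auto
  define S' where "S' = (\<lambda>k\<in>{1..r}. {s. s + i \<in> S k})"
  \<comment> \<open>A tile starting at \<open>s < i\<close> meets the first tile in the point
    \<open>s\<close>, hence is that tile.\<close>
  have small: "k = i \<and> s = 0" if "k \<in> {1..r}" "s \<in> S k" "s < i" for k s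
    using D[of k s i 0 s] that i by auto
  have "S = prepend_part r i S'"
  proof (rule extensionalityI[of _ "{1..r}"])
    fix k assume k: "k \<in> {1..r}"
    have "s \<in> S k \<longleftrightarrow> s \<in> prepend_part r i S' k" for s
    proof (cases "s < i")
      case True
      then show ?thesis using small[OF k, of s] i k by (auto simp: prepend_part_def)
    next
      case False
      then show ?thesis using i k
        by (auto simp: prepend_part_def S'_def intro!: image_eqI[of _ _ "s - i"])
    qed
    then show "S k = prepend_part r i S' k" by blast
  qed (use E in \<open>auto simp: prepend_part_def\<close>)
  moreover have "S' \<in> shadowed_partitions r (n - i)"
    unfolding shadowed_partitions_iff
  proof (intro conjI ballI allI impI)
    show "S' \<in> extensional {1..r}" by (simp add: S'_def)
  next
    fix k s assume "k \<in> {1..r}" "s \<in> S' k"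
    then show "s + k \<le> n - i" using B[of k "s + i"] by (auto simp: S'_def)
  next
    fix m assume "m < n - i"
    then obtain k s where ks: "k \<in> {1..r}" "s \<in> S k" "s \<le> m + i" "m + i < s + k"
      using C[of "m + i"] less_diff_conv by blast
    then have "i \<le> s" using small[of k s] by force
    then show "\<exists>k\<in>{1..r}. \<exists>s\<in>S' k. s \<le> m \<and> m < s + k"
      using ks by (intro bexI[of _ k] bexI[of _ "s - i"]) (auto simp: S'_def)
  next
    fix k s k' s' m
    assume *: "k \<in> {1..r}" "s \<in> S' k" "k' \<in> {1..r}" "s' \<in> S' k'"
      "s \<le> m \<and> m < s + k \<and> s' \<le> m \<and> m < s' + k'"
    have "(k = k' \<and> s + i = s' + i)"
      using * by (intro D[of _ _ _ _ "m + i"]) (auto simp: S'_def)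
    then show "k = k'" "s = s'" by auto
  qed
  moreover have "i \<le> n" using B[OF i] by simp
  ultimately show ?thesis using that i by blast
qed

text \<open>The length \<open>i\<close> is recovered as the index of the component containing 0, and
  \<open>S\<close> by moving the rest back. The first tile must fit, hence the bound
  \<open>min r n\<close>.\<close>

lemma bij_betw_prepend_part:
  assumes "0 < n"
  shows "bij_betw (\<lambda>(i, S). prepend_part r i S)
    (SIGMA i:{1..min r n}. shadowed_partitions r (n - i)) (shadowed_partitions r n)"
  unfolding bij_betw_def
proof
  show "inj_on (\<lambda>(i, S). prepend_part r i S)
    (SIGMA i:{1..min r n}. shadowed_partitions r (n - i))"
  proof (rule inj_onI, clarify)
    have shift: "s + i \<in> prepend_part r i S k \<longleftrightarrow> s \<in> S k" if "1 \<le> i" "k \<in> {1..r}" for i k s S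
      using that by (auto simp: prepend_part_def)
    fix i S i' S'
    assume i: "i \<in> {1..min r n}" "i' \<in> {1..min r n}"
      and S: "S \<in> shadowed_partitions r (n - i)" "S' \<in> shadowed_partitions r (n - i')"
      and eq: "prepend_part r i S = prepend_part r i' S'"
    have "0 \<in> prepend_part r i S i" using i by (simp add: prepend_part_def)
    then have "0 \<in> prepend_part r i' S' i" by (simp add: eq)
    then have i': "i' = i" using i by (auto simp: prepend_part_def split: if_splits)
    have "S = S'"
    proof (rule extensionalityI[of _ "{1..r}"])
      fix k assume k: "k \<in> {1..r}"
      have "s \<in> S k \<longleftrightarrow> s \<in> S' k" for s
        using shift[of i k s S] shift[of i k s S'] eq i k by (simp add: i')
      then show "S k = S' k" by blast
    qed (use S in \<open>auto simp: shadowed_partitions_def PiE_iff\<close>)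
    then show "i = i' \<and> S = S'" using i' by simp
  qed
  show "(\<lambda>(i, S). prepend_part r i S) `
    (SIGMA i:{1..min r n}. shadowed_partitions r (n - i)) = shadowed_partitions r n"
    by (fastforce intro: prepend_part_in elim: shadowed_partitions_cases[OF _ assms])
qed

lemma finite_shadowed_partitions: "finite (shadowed_partitions r n)"
  unfolding shadowed_partitions_def
  by (rule finite_subset[OF Collect_restrict]) (auto intro: finite_PiE)

lemma shadowed_partitions_0: "shadowed_partitions r 0 = {\<lambda>i\<in>{1..r}. {}}"
proof (intro equalityI subsetI)
  fix S assume "S \<in> shadowed_partitions r 0"
  then have "S \<in> {1..r} \<rightarrow>\<^sub>E {{}}"
    unfolding shadowed_partitions_def by simp
  then have "S = (\<lambda>i\<in>{1..r}. {})"
    by (intro extensionalityI[of _ "{1..r}"]) (auto simp: PiE_iff)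
  then show "S \<in> {\<lambda>i\<in>{1..r}. {}}" by simp
next
  fix S assume "S \<in> {\<lambda>i\<in>{1..r}. {} :: nat set}"
  then show "S \<in> shadowed_partitions r 0"
    unfolding shadowed_partitions_iff by simp
qed

lemma weight_prepend_part:
  assumes "finite (S k)" "k \<in> {1..r}" "1 \<le> i"
  shows "weight q (prepend_part r i S k) = (if k = i then 1 else 0) + weight q (S k) * q ^ i"
proof -
  have "weight q ((\<lambda>s. s + i) ` S k) = weight q (S k) * q ^ i"
    unfolding weight_def by (simp add: sum.reindex power_add sum_distrib_right)
  moreover have "0 \<notin> (\<lambda>s. s + i) ` S k" using assms by auto
  ultimately show ?thesis
    using assms unfolding weight_def
    by (cases "k = i") (simp_all add: prepend_part_def)
qed

lemma tuple_power_prepend_part: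
  assumes "\<And>k. k \<in> {1..r} \<Longrightarrow> finite (S k)" "i \<in> {1..r}"
  shows "tuple_power q r A (prepend_part r i S) = A i * tuple_power q r A S ^ (q ^ i)"
proof -
  have "tuple_power q r A (prepend_part r i S) =
      (\<Prod>k=1..r. (if k = i then A i else 1) * (A k ^ weight q (S k)) ^ (q ^ i))"
    unfolding tuple_power_def using assms
    by (intro prod.cong) (auto simp: weight_prepend_part power_add power_mult)
  then show ?thesis
    using assms by (simp add: prod.distrib tuple_power_def prod_power_distrib)
qed

text \<open>A bracket depends only on the distance of its point from \<open>n\<close>, which the
  shift preserves; only the exponent gains the factor \<open>q ^ i\<close>. The point 0 contributes
  \<open>bracket q T n\<close>.\<close>

lemma D_prod_prepend_part:
  assumes "\<And>k. k \<in> {1..r} \<Longrightarrow> finite (S k)" "i \<in> {1..r}"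
  shows "D_prod q T n (\<Union>k\<in>{1..r}. prepend_part r i S k) =
    bracket q T n * D_prod q T (n - i) (\<Union>k\<in>{1..r}. S k) ^ (q ^ i)"
proof -
  let ?U = "\<Union>k\<in>{1..r}. S k"
  have "(\<Union>k\<in>{1..r}. prepend_part r i S k) = insert 0 ((\<lambda>s. s + i) ` ?U)"
    using assms(2) by (force simp: prepend_part_def split: if_splits)
  moreover have "finite ?U" using assms(1) by blast
  moreover have "0 \<notin> (\<lambda>s. s + i) ` ?U" using assms(2) by auto
  ultimately have "D_prod q T n (\<Union>k\<in>{1..r}. prepend_part r i S k) =
      bracket q T n * (\<Prod>s\<in>?U. bracket q T (n - (s + i)) ^ (q ^ (s + i)))"
    unfolding D_prod_def by (simp add: prod.reindex)
  moreover have "n - (s + i) = n - i - s" for s by simp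
  ultimately show ?thesis
    unfolding D_prod_def by (simp add: prod_power_distrib power_add power_mult)
qed

text \<open>The coefficients of the theorem, detached from the Drinfeld module so that their
  recursion holds over any field where the \<open>q\<close>-th power is additive.\<close>

definition partition_coeff :: "nat \<Rightarrow> nat \<Rightarrow> (nat \<Rightarrow> 'a::field) \<Rightarrow> 'a \<Rightarrow> nat \<Rightarrow> 'a" where
  "partition_coeff q r A T n = (\<Sum>S\<in>shadowed_partitions r n.
     tuple_power q r A S / D_prod q T n (\<Union>i\<in>{1..r}. S i))"

lemma partition_coeff_0: "partition_coeff q r A T 0 = 1"
  by (simp add: partition_coeff_def shadowed_partitions_0 tuple_power_def weight_def D_prod_def)

text \<open>Grouping the tilings by their first tile turns each summand into \<open>A i\<close>
  times a \<open>q ^ i\<close>-th power over \<open>bracket q T n\<close>; additivity moves that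
  power outside the inner sum.\<close>

lemma partition_coeff_rec:
  fixes A :: "nat \<Rightarrow> 'a::field"
  assumes "0 < q" and add: "\<And>x y :: 'a. (x + y) ^ q = x ^ q + y ^ q" and "0 < n"
  shows "partition_coeff q r A T n =
    (\<Sum>i=1..min r n. A i * partition_coeff q r A T (n - i) ^ (q ^ i)) / bracket q T n"
proof -
  let ?g = "\<lambda>n S. tuple_power q r A S / D_prod q T n (\<Union>i\<in>{1..r}. S i)"
  have step: "?g n (prepend_part r i S) = A i * ?g (n - i) S ^ (q ^ i) / bracket q T n"
    if "i \<in> {1..min r n}" "S \<in> shadowed_partitions r (n - i)" for i S
  proof -
    have "finite (S k)" if "k \<in> {1..r}" for k
      using \<open>S \<in> _\<close> that finite_subset[of "S k" "{..<n - i}"]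
      unfolding shadowed_partitions_def PiE_iff by blast
    then show ?thesis
      using that by (subst tuple_power_prepend_part, simp, simp, subst D_prod_prepend_part)
        (simp_all add: power_divide mult.commute)
  qed
  have frob: "(\<Sum>S\<in>shadowed_partitions r (n - i). ?g (n - i) S ^ (q ^ i)) =
      partition_coeff q r A T (n - i) ^ (q ^ i)" for i
    unfolding partition_coeff_def using \<open>0 < q\<close>
    by (intro additive_power_sum[symmetric] additive_power_iterate add) simp
  have "partition_coeff q r A T n =
      (\<Sum>(i, S)\<in>(SIGMA i:{1..min r n}. shadowed_partitions r (n - i)). ?g n (prepend_part r i S))"
    unfolding partition_coeff_def
    using sum.reindex_bij_betw[OF bij_betw_prepend_part[OF \<open>0 < n\<close>], of "?g n", symmetric]
    by (simp add: case_prod_unfold)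
  also have "\<dots> = (\<Sum>i=1..min r n. \<Sum>S\<in>shadowed_partitions r (n - i). ?g n (prepend_part r i S))"
    by (rule sum.Sigma[symmetric]) (auto simp: finite_shadowed_partitions)
  also have "\<dots> = (\<Sum>i=1..min r n. \<Sum>S\<in>shadowed_partitions r (n - i).
      A i * ?g (n - i) S ^ (q ^ i) / bracket q T n)"
    using step by (intro sum.cong) auto
  also have "\<dots> = (\<Sum>i=1..min r n. A i * (\<Sum>S\<in>shadowed_partitions r (n - i).
      ?g (n - i) S ^ (q ^ i)) / bracket q T n)"
    by (simp add: sum_distrib_left sum_divide_distrib)
  finally show ?thesis unfolding frob by (simp add: sum_divide_distrib)
qed

section \<open>Growth of the coefficients\<close>

lemma tendsto_0_squeeze:
  fixes f g :: "nat \<Rightarrow> real"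
  assumes "g \<longlonglongrightarrow> 0" "\<And>n. N \<le> n \<Longrightarrow> 0 \<le> f n" "\<And>n. N \<le> n \<Longrightarrow> f n \<le> g n"
  shows "f \<longlonglongrightarrow> 0"
  by (rule tendsto_sandwich[OF _ _ tendsto_const assms(1)])
    (use assms in \<open>auto simp: eventually_sequentially\<close>)

text \<open>
  Put \<open>c\<^sub>n = a\<^sub>n \<rho>\<^bsup>Q\<^sup>n\<^esup>\<close>; the recursion for \<open>c\<close> is the same as for \<open>a\<close>.  For small \<open>\<rho>\<close> it keeps all
  \<open>c\<^sub>n\<close> below \<open>1\<close>, and once they are eventually below \<open>1\<close>, the factor \<open>Q\<^bsup>Q\<^sup>n\<^esup>\<close> allows one to
  replace \<open>\<rho>\<close> by \<open>3/2 \<rho>\<close>.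
\<close>

lemma doubly_exponential_decay:
  fixes a :: "nat \<Rightarrow> real" and Q :: nat
  assumes Q: "2 \<le> Q" and nonneg: "\<And>n. 0 \<le> a n" and "0 \<le> C" "0 \<le> R"
    and rec: "\<And>n. 1 \<le> n \<Longrightarrow>
      \<exists>i\<in>{1..min r n}. a n * real Q ^ (Q ^ n) \<le> C * a (n - i) ^ (Q ^ i)"
  shows "(\<lambda>n. a n * R ^ (Q ^ n)) \<longlonglongrightarrow> 0"
proof -
  have le_pow: "n \<le> Q ^ n" for n
    using self_le_power[of Q n] Q less_exp[of n] power_mono[of 2 Q n] by linarith
  have C_small: "\<exists>N. \<forall>n\<ge>N. C * c ^ n \<le> 1" if "0 \<le> c" "c < 1" for c :: real
  proof -
    have "(\<lambda>n. C * c ^ n) \<longlonglongrightarrow> C * 0"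
      using that by (intro tendsto_intros LIMSEQ_power_zero) simp
    then have "\<forall>\<^sub>F n in sequentially. C * c ^ n < 1"
      by (rule order_tendstoD) simp
    then show ?thesis unfolding eventually_sequentially by (meson less_imp_le)
  qed
  have rec_scaled: "\<exists>i\<in>{1..min r n}. (a n * \<rho> ^ (Q ^ n)) * real Q ^ (Q ^ n) \<le>
      C * (a (n - i) * \<rho> ^ (Q ^ (n - i))) ^ (Q ^ i)" if "1 \<le> n" "0 \<le> \<rho>" for n \<rho>
  proof -
    obtain i where i: "i \<in> {1..min r n}" "a n * real Q ^ (Q ^ n) \<le> C * a (n - i) ^ (Q ^ i)"
      using rec[OF \<open>1 \<le> n\<close>] by blast
    have "Q ^ (n - i) * Q ^ i = Q ^ n"
      using i(1) by (simp flip: power_add)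
    then have "C * (a (n - i) * \<rho> ^ (Q ^ (n - i))) ^ (Q ^ i) = C * a (n - i) ^ (Q ^ i) * \<rho> ^ (Q ^ n)"
      by (simp add: power_mult_distrib flip: power_mult)
    moreover have "a n * real Q ^ (Q ^ n) * \<rho> ^ (Q ^ n) \<le> C * a (n - i) ^ (Q ^ i) * \<rho> ^ (Q ^ n)"
      using i(2) \<open>0 \<le> \<rho>\<close> by (intro mult_right_mono) auto
    moreover have "a n * real Q ^ (Q ^ n) * \<rho> ^ (Q ^ n) = (a n * \<rho> ^ (Q ^ n)) * real Q ^ (Q ^ n)"
      by (simp add: mult_ac)
    ultimately have "(a n * \<rho> ^ (Q ^ n)) * real Q ^ (Q ^ n) \<le>
      C * (a (n - i) * \<rho> ^ (Q ^ (n - i))) ^ (Q ^ i)" by linarith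
    then show ?thesis using i(1) by blast
  qed
  define bd where "bd = (\<lambda>\<rho>. \<exists>N. \<forall>n\<ge>N. a n * \<rho> ^ (Q ^ n) \<le> 1)"
  have "\<exists>\<rho>>0. bd \<rho>"
  proof -
    obtain N where N: "\<And>n. N \<le> n \<Longrightarrow> C * (1 / 2) ^ n \<le> 1"
      using C_small[of "1 / 2"] by auto
    \<comment> \<open>Chosen so that \<open>\<rho> \<le> 1\<close> and
      \<open>a n * \<rho> \<le> 1\<close> for all \<open>n \<le> N\<close>.\<close>
    define \<rho> where "\<rho> = 1 / (1 + sum a {..N})"
    have pos: "0 < 1 + sum a {..N}"
      by (intro add_pos_nonneg sum_nonneg nonneg) simp
    then have \<rho>: "0 < \<rho>" "\<rho> \<le> 1"
      unfolding \<rho>_def using sum_nonneg[of "{..N}" a] nonneg by (auto simp: divide_simps)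
    have "a n * \<rho> ^ (Q ^ n) \<le> 1" for n
    proof (induction n rule: less_induct)
      case (less n)
      show ?case
      proof (cases "n \<le> N")
        case True
        have "\<rho> ^ (Q ^ n) \<le> \<rho>"
          using power_decreasing[of 1 "Q ^ n" \<rho>] \<rho> Q by simp
        then have "a n * \<rho> ^ (Q ^ n) \<le> a n * \<rho>"
          by (intro mult_left_mono nonneg)
        also have "a n \<le> 1 + sum a {..N}"
          using member_le_sum[of n "{..N}" a] nonneg True by simp
        then have "a n * \<rho> \<le> 1"
          unfolding \<rho>_def using pos by (simp add: divide_simps)
        finally show ?thesis .
      next
        case False
        then obtain i where i: "i \<in> {1..min r n}"
          "(a n * \<rho> ^ (Q ^ n)) * real Q ^ (Q ^ n) \<le> C * (a (n - i) * \<rho> ^ (Q ^ (n - i))) ^ (Q ^ i)"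
          using rec_scaled[of n \<rho>] \<rho> by auto
        have "(a (n - i) * \<rho> ^ (Q ^ (n - i))) ^ (Q ^ i) \<le> 1"
          using less.IH[of "n - i"] i(1) nonneg \<rho> by (intro power_le_one) auto
        then have "(a n * \<rho> ^ (Q ^ n)) * real Q ^ (Q ^ n) \<le> C"
          using i(2) \<open>0 \<le> C\<close> mult_left_le[of _ C] by (meson order_trans)
        \<comment> \<open>By the choice of \<open>N\<close>, the constant is at most
          \<open>2 ^ n\<close>, which the factor \<open>Q ^ (Q ^ n)\<close> outweighs.\<close>
        also have "C \<le> 2 ^ n"
          using N[of n] False by (simp add: divide_simps)
        also have "(2::real) ^ n \<le> real Q ^ n"
          using Q by (intro power_mono) auto
        also have "\<dots> \<le> real Q ^ (Q ^ n)"
          using le_pow[of n] Q by (intro power_increasing) auto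
        finally show ?thesis using Q by simp
      qed
    qed
    then show ?thesis unfolding bd_def using \<rho> by blast
  qed
  then obtain \<rho> where \<rho>: "0 < \<rho>" "bd \<rho>" by blast
  have step: "bd (\<sigma> * (3 / 2))" if \<sigma>: "bd \<sigma>" "0 < \<sigma>" for \<sigma>
  proof -
    obtain N where N: "\<And>n. N \<le> n \<Longrightarrow> a n * \<sigma> ^ (Q ^ n) \<le> 1"
      using \<sigma> unfolding bd_def by blast
    obtain M where M: "\<And>n. M \<le> n \<Longrightarrow> C * (3 / 4) ^ n \<le> 1"
      using C_small[of "3 / 4"] by auto
    \<comment> \<open>The offset \<open>r\<close> keeps \<open>n - i\<close> beyond
      \<open>N\<close>. In \<open>3 / 2 = 2 * (3 / 4)\<close> the powers of 2 come from the
      recursion, and those of \<open>3 / 4\<close> absorb \<open>C\<close>.\<close>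
    have "a n * (\<sigma> * (3 / 2)) ^ (Q ^ n) \<le> 1" if n: "max (N + r + 1) M \<le> n" for n
    proof -
      obtain i where i: "i \<in> {1..min r n}"
        "(a n * \<sigma> ^ (Q ^ n)) * real Q ^ (Q ^ n) \<le> C * (a (n - i) * \<sigma> ^ (Q ^ (n - i))) ^ (Q ^ i)"
        using rec_scaled[of n \<sigma>] \<sigma> n by auto
      have "(a (n - i) * \<sigma> ^ (Q ^ (n - i))) ^ (Q ^ i) \<le> 1"
        using N[of "n - i"] i(1) n nonneg \<sigma> by (intro power_le_one) auto
      then have "(a n * \<sigma> ^ (Q ^ n)) * real Q ^ (Q ^ n) \<le> C"
        using i(2) \<open>0 \<le> C\<close> mult_left_le[of _ C] by (meson order_trans)
      moreover have "(a n * \<sigma> ^ (Q ^ n)) * 2 ^ (Q ^ n) \<le> (a n * \<sigma> ^ (Q ^ n)) * real Q ^ (Q ^ n)"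
        using Q nonneg \<sigma> by (intro mult_left_mono power_mono) auto
      ultimately have "(a n * \<sigma> ^ (Q ^ n)) * 2 ^ (Q ^ n) * (3 / 4) ^ (Q ^ n) \<le> C * (3 / 4) ^ (Q ^ n)"
        by (intro mult_right_mono) auto
      moreover have "\<dots> \<le> 1"
        using M[of "Q ^ n"] le_pow[of n] n by simp
      moreover have "(2::real) ^ (Q ^ n) * (3 / 4) ^ (Q ^ n) = (3 / 2) ^ (Q ^ n)"
        by (simp flip: power_mult_distrib)
      ultimately have "(a n * \<sigma> ^ (Q ^ n)) * (3 / 2) ^ (Q ^ n) \<le> 1"
        by (simp only: mult.assoc)
      then show ?thesis by (simp only: power_mult_distrib mult.assoc)
    qed
    then show ?thesis unfolding bd_def by blast
  qed
  have bd_iter: "bd (\<rho> * (3 / 2) ^ k)" for k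
  proof (induction k)
    case (Suc k)
    then show ?case using step[of "\<rho> * (3 / 2) ^ k"] \<rho> by (simp add: mult_ac)
  qed (use \<rho> in simp)
  \<comment> \<open>Aiming at \<open>2 * R\<close> instead of \<open>R\<close> leaves a spare factor
    \<open>(1 / 2) ^ (Q ^ n)\<close>, which turns boundedness into convergence to 0.\<close>
  obtain k where "2 * R / \<rho> < (3 / 2) ^ k"
    using real_arch_pow[of "3 / 2"] by auto
  then have k: "2 * R \<le> \<rho> * (3 / 2) ^ k"
    using \<rho> by (simp add: divide_simps mult_ac)
  obtain N where N: "\<And>n. N \<le> n \<Longrightarrow> a n * (\<rho> * (3 / 2) ^ k) ^ (Q ^ n) \<le> 1"
    using bd_iter[of k] unfolding bd_def by blast
  have "a n * R ^ (Q ^ n) \<le> (1 / 2) ^ n" if "N \<le> n" for n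
  proof -
    have "a n * (2 * R) ^ (Q ^ n) \<le> a n * (\<rho> * (3 / 2) ^ k) ^ (Q ^ n)"
      using k \<open>0 \<le> R\<close> nonneg by (intro mult_left_mono power_mono) auto
    also have "\<dots> \<le> 1" using N that by simp
    finally have "a n * R ^ (Q ^ n) \<le> (1 / 2) ^ (Q ^ n)"
      by (simp add: power_mult_distrib divide_simps mult_ac)
    also have "\<dots> \<le> (1 / 2) ^ n"
      using le_pow[of n] by (intro power_decreasing) auto
    finally show ?thesis .
  qed
  note le = this
  have "(\<lambda>n. (1 / 2 :: real) ^ n) \<longlonglongrightarrow> 0"
    by (intro LIMSEQ_power_zero) simp
  then show ?thesis
    by (rule tendsto_0_squeeze[OF _ _ le]) (use nonneg \<open>0 \<le> R\<close> in auto)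
qed

section \<open>Formal \<open>q\<close>-series\<close>

context includes fps_syntax
begin

text \<open>Additivity covers only finite sums, so \<open>F\<close> is cut after degree
  \<open>n\<close>: the \<open>m\<close>-th power of the tail starts at degree
  \<open>Suc n * m > n\<close> or later and does not affect coefficient \<open>n\<close>.\<close>

lemma fps_power_nth_additive:
  fixes F :: "'a::field fps"
  assumes "0 < m" and add: "\<And>F G :: 'a fps. (F + G) ^ m = F ^ m + G ^ m"
  shows "(F ^ m) $ n = (if m dvd n then (F $ (n div m)) ^ m else 0)"
proof -
  define P where "P = (\<Sum>k\<le>n. fps_const (F $ k) * fps_X ^ k)"
  define G where "G = fps_shift (Suc n) F"
  have "F = P + fps_X ^ Suc n * G"
    by (rule fps_ext)
      (auto simp: P_def G_def fps_sum_nth fps_X_power_mult_nth if_distrib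
        simp del: power_Suc cong: if_cong)
  then have "F ^ m = P ^ m + fps_X ^ (Suc n * m) * G ^ m"
    by (metis add power_mult_distrib power_mult)
  moreover have "Suc n * 1 \<le> Suc n * m"
    using \<open>0 < m\<close> by (intro mult_le_mono2) simp
  then have "n < Suc n * m" by (simp only: mult_1_right Suc_le_eq)
  ultimately have "(F ^ m) $ n = (P ^ m) $ n"
    by (simp add: fps_X_power_mult_nth)
  also have "P ^ m = (\<Sum>k\<le>n. fps_const ((F $ k) ^ m) * fps_X ^ (k * m))"
    unfolding P_def using assms
    by (subst additive_power_sum) (auto simp: power_mult_distrib fps_const_power power_mult)
  also have "\<dots> $ n = (\<Sum>k\<le>n. if n = k * m then (F $ k) ^ m else 0)"
    by (simp add: fps_sum_nth fps_X_power_nth if_distrib cong: if_cong)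
  also have "\<dots> = (\<Sum>k\<le>n. if m dvd n \<and> k = n div m then (F $ (n div m)) ^ m else 0)"
    using \<open>0 < m\<close> by (intro sum.cong refl) auto
  also have "\<dots> = (if m dvd n then (F $ (n div m)) ^ m else 0)"
    by simp
  finally show ?thesis .
qed

lemma q_series_nth_power: "2 \<le> q \<Longrightarrow> q_series q \<beta> $ (q ^ n) = \<beta> n"
  by (simp add: q_series_def power_inject_exp)

lemma q_series_nth_other: "m \<notin> range ((^) q) \<Longrightarrow> q_series q \<beta> $ m = 0"
  unfolding q_series_def by (auto intro!: sum.neutral)

lemma q_series_eqI:
  assumes "2 \<le> q" "\<And>n. F $ (q ^ n) = \<beta> n" "\<And>m. m \<notin> range ((^) q) \<Longrightarrow> F $ m = 0"
  shows "F = q_series q \<beta>"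
proof (rule fps_ext)
  fix m
  show "F $ m = q_series q \<beta> $ m"
    using assms by (cases "m \<in> range ((^) q)") (auto simp: q_series_nth_power q_series_nth_other)
qed

lemma q_series_inject: "2 \<le> q \<Longrightarrow> q_series q \<beta> = q_series q \<gamma> \<longleftrightarrow> \<beta> = \<gamma>"
  by (metis ext q_series_nth_power)

lemma q_series_compose_linear:
  "2 \<le> q \<Longrightarrow> fps_compose (q_series q \<beta>) (fps_const T * fps_X) = q_series q (\<lambda>n. \<beta> n * T ^ (q ^ n))"
  by (rule q_series_eqI)
    (simp_all add: fps_compose_linear q_series_nth_power q_series_nth_other)

text \<open>The coefficients of \<open>\<Sum>\<^sub>i A\<^sub>i (\<Sum>\<^sub>n \<beta>\<^sub>n X\<^bsup>q\<^sup>n\<^esup>)\<^bsup>q\<^sup>i\<^esup>\<close>.\<close>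

definition twisted_coeff :: "nat \<Rightarrow> nat \<Rightarrow> (nat \<Rightarrow> 'a::field) \<Rightarrow> (nat \<Rightarrow> 'a) \<Rightarrow> nat \<Rightarrow> 'a" where
  "twisted_coeff q r A \<beta> n = (\<Sum>i\<le>r. if i \<le> n then A i * \<beta> (n - i) ^ (q ^ i) else 0)"

lemma q_series_power:
  fixes \<beta> :: "nat \<Rightarrow> 'a::field"
  assumes q: "2 \<le> q" and add: "\<And>F G :: 'a fps. (F + G) ^ q = F ^ q + G ^ q"
  shows "q_series q \<beta> ^ (q ^ i) = q_series q (\<lambda>n. if i \<le> n then \<beta> (n - i) ^ (q ^ i) else 0)"
proof (rule q_series_eqI[OF q])
  have nth: "(q_series q \<beta> ^ (q ^ i)) $ m =
      (if q ^ i dvd m then (q_series q \<beta> $ (m div q ^ i)) ^ (q ^ i) else 0)" for m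
    using q by (intro fps_power_nth_additive additive_power_iterate add) simp
  show "(q_series q \<beta> ^ (q ^ i)) $ (q ^ n) = (if i \<le> n then \<beta> (n - i) ^ (q ^ i) else 0)" for n
  proof (cases "i \<le> n")
    case True
    then have "q ^ n div q ^ i = q ^ (n - i)"
      using q by (simp add: power_diff)
    then show ?thesis
      using True q unfolding nth by (simp add: q_series_nth_power le_imp_power_dvd)
  next
    case False
    then have "\<not> q ^ i dvd q ^ n"
      using q by (auto dest!: dvd_imp_le)
    then show ?thesis using False unfolding nth by simp
  qed
  show "(q_series q \<beta> ^ (q ^ i)) $ m = 0" if m: "m \<notin> range ((^) q)" for m
  proof -
    have "m div q ^ i \<notin> range ((^) q)" if "q ^ i dvd m"
    proof
      assume "m div q ^ i \<in> range ((^) q)"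
      then obtain k where "m div q ^ i = q ^ k" by auto
      then have "m = q ^ (k + i)" using that by (metis dvd_div_mult_self power_add)
      then show False using m by simp
    qed
    then show ?thesis unfolding nth using q by (simp add: q_series_nth_other)
  qed
qed

lemma q_series_twisted_coeff:
  fixes \<beta> :: "nat \<Rightarrow> 'a::field"
  assumes q: "2 \<le> q" and add: "\<And>F G :: 'a fps. (F + G) ^ q = F ^ q + G ^ q"
  shows "(\<Sum>i\<le>r. fps_const (A i) * q_series q \<beta> ^ (q ^ i)) = q_series q (twisted_coeff q r A \<beta>)"
proof (rule q_series_eqI[OF q])
  fix n
  show "(\<Sum>i\<le>r. fps_const (A i) * q_series q \<beta> ^ (q ^ i)) $ (q ^ n) = twisted_coeff q r A \<beta> n"
    unfolding twisted_coeff_def fps_sum_nth q_series_power[OF assms]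
    by (intro sum.cong refl) (simp add: q_series_nth_power[OF q])
next
  fix m assume "m \<notin> range ((^) q)"
  then show "(\<Sum>i\<le>r. fps_const (A i) * q_series q \<beta> ^ (q ^ i)) $ m = 0"
    unfolding fps_sum_nth q_series_power[OF assms]
    by (intro sum.neutral) (simp add: q_series_nth_other)
qed

end

text \<open>The term for \<open>i = 0\<close> is \<open>T * \<beta> n\<close>; moved to the left it
  combines with \<open>T ^ (q ^ n)\<close> to the bracket.\<close>

lemma twisted_coeff_eq:
  assumes "A 0 = T"
  shows "\<beta> n * T ^ (q ^ n) = twisted_coeff q r A \<beta> n \<longleftrightarrow>
    \<beta> n * bracket q T n = (\<Sum>i=1..min r n. A i * \<beta> (n - i) ^ (q ^ i))"
proof -
  have "twisted_coeff q r A \<beta> n = (\<Sum>i=0..min r n. A i * \<beta> (n - i) ^ (q ^ i))"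
    unfolding twisted_coeff_def
    by (rule sum.mono_neutral_cong_right) auto
  also have "\<dots> = T * \<beta> n + (\<Sum>i=1..min r n. A i * \<beta> (n - i) ^ (q ^ i))"
    using assms by (simp add: sum.atLeast_Suc_atMost)
  finally show ?thesis by (auto simp: bracket_def algebra_simps)
qed

text \<open>The right side of the recursion involves only smaller indices, and the non-zero bracket
  cancels, so the initial value determines everything.\<close>

lemma twisted_coeff_unique:
  assumes "A 0 = T" and nz: "\<And>n. 1 \<le> n \<Longrightarrow> bracket q T n \<noteq> 0" and "\<beta> 0 = \<gamma> 0"
    and \<beta>: "\<And>n. \<beta> n * T ^ (q ^ n) = twisted_coeff q r A \<beta> n"
    and \<gamma>: "\<And>n. \<gamma> n * T ^ (q ^ n) = twisted_coeff q r A \<gamma> n"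
  shows "\<beta> = \<gamma>"
proof
  fix n
  show "\<beta> n = \<gamma> n"
  proof (induction n rule: less_induct)
    case (less n)
    show ?case
    proof (cases "n = 0")
      case False
      have "\<beta> n * bracket q T n = (\<Sum>i=1..min r n. A i * \<beta> (n - i) ^ (q ^ i))"
        using \<beta> twisted_coeff_eq[of A T, OF \<open>A 0 = T\<close>] by blast
      also have "\<dots> = (\<Sum>i=1..min r n. A i * \<gamma> (n - i) ^ (q ^ i))"
        using less by (intro sum.cong refl) auto
      also have "\<dots> = \<gamma> n * bracket q T n"
        using \<gamma> twisted_coeff_eq[of A T, OF \<open>A 0 = T\<close>] by metis
      finally show ?thesis using nz[of n] False by simp
    qed (use \<open>\<beta> 0 = \<gamma> 0\<close> in simp)
  qed
qed

section \<open>Series over \<open>\<complex>\<^sub>\<infinity>\<close>\<close>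

context C_infinity
begin

section \<open>The ultrametric absolute value attached to \<open>v\<close>\<close>

definition absv :: "'a \<Rightarrow> real" where
  "absv x = dist x 0"

lemma absv_eq: "absv x = (if x = 0 then 0 else real CARD('k) powr (- real_of_ereal (v x)))"
  by (simp add: absv_def dist_v)

lemma dist_eq_absv: "dist x y = absv (x - y)"
  by (simp add: absv_eq dist_v)

lemma absv_nonneg [simp]: "0 \<le> absv x"
  by (simp add: absv_def)

lemma absv_0 [simp]: "absv 0 = 0"
  by (simp add: absv_def)

lemma absv_eq_0_iff [simp]: "absv x = 0 \<longleftrightarrow> x = 0"
  by (simp add: absv_def)

lemma absv_mult: "absv (x * y) = absv x * absv y"
proof (cases "x = 0 \<or> y = 0")
  case False
  then obtain a b where "v x = ereal a" "v y = ereal b"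
    using v_infinity_iff v_not_minus_infinity by (metis ereal_cases)
  then show ?thesis using False by (simp add: absv_eq v_mult flip: powr_add)
qed auto

lemma absv_power: "absv (x ^ n) = absv x ^ n"
proof (induction n)
  case 0
  have "absv 1 * absv 1 = absv 1" by (simp flip: absv_mult)
  then show ?case by simp
qed (simp add: absv_mult)

lemma absv_minus [simp]: "absv (- x) = absv x"
proof -
  have "absv (- x) ^ 2 = absv x ^ 2"
    by (simp flip: absv_power)
  then show ?thesis by (simp add: power2_eq_iff_nonneg)
qed

lemma absv_add_le_max: "absv (x + y) \<le> max (absv x) (absv y)"
proof (cases "x = 0 \<or> y = 0 \<or> x + y = 0")
  case False
  then obtain a b c where v: "v x = ereal a" "v y = ereal b" "v (x + y) = ereal c"
    using v_infinity_iff v_not_minus_infinity by (metis ereal_cases)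
  have "min a b \<le> c" using v_add[of x y] by (auto simp: v min_def split: if_splits)
  then have "- c \<le> max (- a) (- b)" by linarith
  then have "real CARD('k) powr - c \<le> real CARD('k) powr (max (- a) (- b))"
    using card_field_gt_1[where 'k = 'k] by (intro powr_mono) auto
  then show ?thesis using False v by (auto simp: absv_eq max_def split: if_splits)
qed (auto simp: max_def not_le less_imp_le)

lemma absv_add_le: "absv (x + y) \<le> absv x + absv y"
  by (rule order_trans[OF absv_add_le_max]) simp

lemma absv_T: "absv T = real CARD('k)"
  using v_T v_infinity_iff[of T] card_field_gt_1[where 'k = 'k]
  by (auto simp: absv_eq one_ereal_def)

lemma absv_sum_le:
  assumes "0 \<le> B" "\<And>x. x \<in> X \<Longrightarrow> absv (f x) \<le> B"
  shows "absv (sum f X) \<le> B"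
  using assms
proof (induction X rule: infinite_finite_induct)
  case (insert x X)
  have "absv (f x) \<le> B" "absv (sum f X) \<le> B" using insert by auto
  then show ?case using insert.hyps absv_add_le_max[of "f x" "sum f X"] by simp
qed auto

text \<open>Ultrametrically a sum is bounded by its largest term. A single witness is what the
  hypothesis of \<open>doubly_exponential_decay\<close> asks for.\<close>

lemma absv_sum_le_some:
  assumes "finite X" "X \<noteq> {}"
  shows "\<exists>x\<in>X. absv (sum f X) \<le> absv (f x)"
proof -
  have "Max ((\<lambda>x. absv (f x)) ` X) \<in> (\<lambda>x. absv (f x)) ` X"
    using assms by (intro Max_in) auto
  then obtain x where x: "x \<in> X" "Max ((\<lambda>x. absv (f x)) ` X) = absv (f x)" by auto
  have "absv (f y) \<le> absv (f x)" if "y \<in> X" for y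
    using Max_ge[of "(\<lambda>x. absv (f x)) ` X" "absv (f y)"] assms that x(2) by simp
  then have "absv (sum f X) \<le> absv (f x)" by (intro absv_sum_le) auto
  then show ?thesis using x by blast
qed

text \<open>In the sum of the bracket and \<open>T\<close> the summand \<open>T\<close> is strictly
  smaller than the total, so ultrametrically the bracket is at least as large as the total.\<close>

lemma absv_power_T_le_bracket:
  assumes "1 \<le> n"
  shows "real CARD('k) ^ (CARD('k) ^ n) \<le> absv (bracket CARD('k) T n)"
proof -
  let ?q = "CARD('k)"
  have q: "1 < ?q" by (rule card_field_gt_1)
  have "real ?q ^ 1 < real ?q ^ (?q ^ n)"
    using q assms one_less_power[of ?q n] by (intro power_strict_increasing) auto
  then have "absv T < absv (T ^ (?q ^ n))" by (simp add: absv_power absv_T)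
  then have "absv (T ^ (?q ^ n)) \<le> absv (T ^ (?q ^ n) - T)"
    using absv_add_le_max[of "T ^ (?q ^ n) - T" T] by simp
  then show ?thesis by (simp add: bracket_def absv_power absv_T)
qed

lemma bracket_nonzero: "1 \<le> n \<Longrightarrow> bracket CARD('k) T n \<noteq> 0"
  using less_le_trans[OF zero_less_power absv_power_T_le_bracket[of n]]
  by (auto simp: zero_less_card_finite)

section \<open>Constants and additivity of the Frobenius power\<close>

lemma const_0 [simp]: "\<iota> 0 = 0"
  using const_add[of 0 0] by (metis add_0 add_cancel_right_left)

lemma const_of_nat: "\<iota> (of_nat n) = of_nat n"
  by (induction n) (simp_all add: const_add const_one)

lemma const_power: "\<iota> (c ^ n) = \<iota> c ^ n"
  by (induction n) (simp_all add: const_mult const_one)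

lemma const_power_card: "\<iota> c ^ (CARD('k) ^ n) = \<iota> c"
proof (induction n)
  case (Suc n)
  then show ?case
    by (simp add: power_mult flip: const_power)
      (simp add: finite_field_power_card power_mult)
qed simp

lemma binomial_eq_0: "0 < i \<Longrightarrow> i < CARD('k) \<Longrightarrow> of_nat (CARD('k) choose i) = (0 :: 'a)"
  by (metis binomial_card_eq_0 const_0 const_of_nat)

lemma power_card_add: "((x :: 'a) + y) ^ CARD('k) = x ^ CARD('k) + y ^ CARD('k)"
  by (rule binomial_power_add) (auto simp: binomial_eq_0 zero_less_card_finite)

lemma fps_power_card_add:
  "((F :: 'a fps) + G) ^ CARD('k) = F ^ CARD('k) + G ^ CARD('k)"
  by (rule binomial_power_add)
    (auto simp: binomial_eq_0 zero_less_card_finite simp flip: fps_of_nat)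

lemma power_card_power_add:
  "((x :: 'a) + y) ^ (CARD('k) ^ n) = x ^ (CARD('k) ^ n) + y ^ (CARD('k) ^ n)"
  by (rule additive_power_iterate) (rule power_card_add)

lemma power_card_power_diff:
  "((x :: 'a) - y) ^ (CARD('k) ^ n) = x ^ (CARD('k) ^ n) - y ^ (CARD('k) ^ n)"
  using power_card_power_add[of "x - y" y n] by (simp add: eq_diff_eq)

section \<open>Convergent series\<close>

text \<open>
  The sort of \<open>'a\<close> does not make addition and multiplication continuous, so that the library
  lemmas on series do not apply.
\<close>

lemma sums_iff_absv: "(f :: nat \<Rightarrow> 'a) sums s \<longleftrightarrow> (\<lambda>n. absv (sum f {..<n} - s)) \<longlonglongrightarrow> 0"
  unfolding sums_def by (subst tendsto_dist_iff) (simp add: dist_eq_absv)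

lemma sums_add_absv:
  fixes f :: "nat \<Rightarrow> 'a"
  assumes "f sums s" "g sums t"
  shows "(\<lambda>n. f n + g n) sums (s + t)"
proof -
  have lim: "(\<lambda>n. absv (sum f {..<n} - s) + absv (sum g {..<n} - t)) \<longlonglongrightarrow> 0"
    using assms tendsto_add unfolding sums_iff_absv by fastforce
  have "absv ((\<Sum>i<n. f i + g i) - (s + t)) \<le>
      absv (sum f {..<n} - s) + absv (sum g {..<n} - t)" for n
    using absv_add_le[of "sum f {..<n} - s" "sum g {..<n} - t"]
    by (simp add: sum.distrib algebra_simps)
  then show ?thesis unfolding sums_iff_absv
    by (intro tendsto_0_squeeze[OF lim]) auto
qed

text \<open>The power is additive, so the error of the partial sums is \<open>c\<close> times the
  same power of the original error, which tends to 0.\<close>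

lemma sums_scaled_power:
  fixes f :: "nat \<Rightarrow> 'a"
  assumes "f sums s"
  shows "(\<lambda>n. c * f n ^ (CARD('k) ^ i)) sums (c * s ^ (CARD('k) ^ i))"
proof -
  let ?Q = "CARD('k) ^ i"
  have "(\<lambda>n. absv c * absv (sum f {..<n} - s) ^ ?Q) \<longlonglongrightarrow> absv c * 0 ^ ?Q"
    using assms unfolding sums_iff_absv by (intro tendsto_intros)
  moreover have "(\<Sum>j<n. c * f j ^ ?Q) - c * s ^ ?Q = c * (sum f {..<n} - s) ^ ?Q" for n
  proof -
    have "sum f {..<n} ^ ?Q = (\<Sum>j<n. f j ^ ?Q)"
      by (rule additive_power_sum) (simp_all add: power_card_power_add)
    then show ?thesis
      by (simp add: power_card_power_diff right_diff_distrib sum_distrib_left)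
  qed
  ultimately show ?thesis
    unfolding sums_iff_absv by (simp add: absv_mult absv_power zero_power)
qed

lemma sums_mult_absv: "(f :: nat \<Rightarrow> 'a) sums s \<Longrightarrow> (\<lambda>n. c * f n) sums (c * s)"
  using sums_scaled_power[of f s c 0] by simp

lemma sums_diff_absv: "(f :: nat \<Rightarrow> 'a) sums s \<Longrightarrow> g sums t \<Longrightarrow> (\<lambda>n. f n - g n) sums (s - t)"
  using sums_add_absv[of f s "\<lambda>n. - 1 * g n" "- 1 * t"] sums_mult_absv[of g t "- 1"] by simp

lemma sums_sum_absv:
  fixes f :: "'i \<Rightarrow> nat \<Rightarrow> 'a"
  assumes "finite I" "\<And>i. i \<in> I \<Longrightarrow> f i sums s i"
  shows "(\<lambda>n. \<Sum>i\<in>I. f i n) sums (\<Sum>i\<in>I. s i)"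
  using assms by (induction I rule: finite_induct) (auto intro: sums_add_absv)

text \<open>Serves to line up exponents: the \<open>q ^ i\<close>-th power of the term with index
  \<open>n - i\<close> of a \<open>q\<close>-series belongs to \<open>z ^ (q ^ n)\<close>.\<close>

lemma sums_delay:
  fixes f :: "nat \<Rightarrow> 'a"
  assumes "f sums s"
  shows "(\<lambda>n. if i \<le> n then f (n - i) else 0) sums s"
proof -
  have "(\<Sum>n<N + i. if i \<le> n then f (n - i) else 0) = sum f {..<N}" for N
    by (induction N) auto
  then have "(\<lambda>N. \<Sum>n<N + i. if i \<le> n then f (n - i) else 0) \<longlonglongrightarrow> s"
    using assms by (simp add: sums_def)
  then show ?thesis unfolding sums_def by (rule LIMSEQ_offset)
qed

lemma sums_imp_absv_tendsto_0:
  fixes f :: "nat \<Rightarrow> 'a"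
  assumes "f sums s"
  shows "(\<lambda>n. absv (f n)) \<longlonglongrightarrow> 0"
proof -
  let ?d = "\<lambda>n. absv (sum f {..<n} - s)"
  have d: "?d \<longlonglongrightarrow> 0" using assms by (simp add: sums_iff_absv)
  have lim: "(\<lambda>n. ?d (Suc n) + ?d n) \<longlonglongrightarrow> 0"
    using tendsto_add[OF LIMSEQ_Suc[OF d] d] by simp
  have "absv (f n) \<le> ?d (Suc n) + ?d n" for n
    using absv_add_le[of "sum f {..<Suc n} - s" "- (sum f {..<n} - s)"]
    unfolding absv_minus by simp
  then show ?thesis
    by (intro tendsto_0_squeeze[OF lim]) auto
qed

text \<open>Ultrametrically a block of terms is no larger than its largest term, so the partial sums
  are Cauchy as soon as the terms tend to 0.\<close>

lemma summable_if_absv_tendsto_0: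
  fixes f :: "nat \<Rightarrow> 'a"
  assumes "(\<lambda>n. absv (f n)) \<longlonglongrightarrow> 0"
  shows "summable f"
proof -
  have "Cauchy (\<lambda>n. sum f {..<n})"
  proof (rule metric_CauchyI)
    fix e :: real assume "0 < e"
    then have "\<forall>\<^sub>F n in sequentially. absv (f n) < e / 2"
      using order_tendstoD(2)[OF assms, of "e / 2"] by simp
    then obtain N where N: "\<And>n. N \<le> n \<Longrightarrow> absv (f n) < e / 2"
      unfolding eventually_sequentially by blast
    have le: "dist (sum f {..<m}) (sum f {..<n}) < e" if "N \<le> n" "n \<le> m" for m n
    proof -
      have "sum f {..<m} - sum f {..<n} = sum f {n..<m}"
        using \<open>n \<le> m\<close> sum_diff_nat_ivl[of 0 n m f] by (simp add: atLeast0LessThan)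
      moreover have "absv (sum f {n..<m}) \<le> e / 2"
        using N that \<open>0 < e\<close> by (intro absv_sum_le) (auto intro: less_imp_le)
      ultimately show ?thesis using \<open>0 < e\<close> by (simp add: dist_eq_absv)
    qed
    have "dist (sum f {..<m}) (sum f {..<n}) < e" if "N \<le> m" "N \<le> n" for m n
      using le[of n m] le[of m n] that by (cases "n \<le> m") (simp_all add: dist_commute)
    then show "\<exists>M. \<forall>m\<ge>M. \<forall>n\<ge>M. dist (sum f {..<m}) (sum f {..<n}) < e" by blast
  qed
  then show ?thesis
    unfolding summable_def sums_def by (simp add: Cauchy_convergent convergent_def[symmetric])
qed

text \<open>If \<open>absv s\<close> exceeded \<open>B\<close>, the ultrametric inequality would
  keep every error of the partial sums at least \<open>absv s\<close>, against convergence.\<close>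

lemma absv_suminf_le:
  fixes f :: "nat \<Rightarrow> 'a"
  assumes "f sums s" "0 \<le> B" "\<And>n. absv (f n) \<le> B"
  shows "absv s \<le> B"
proof (rule ccontr)
  assume "\<not> absv s \<le> B"
  have "absv s \<le> max (absv (sum f {..<n} - s)) B" for n
  proof -
    have "absv s \<le> max (absv (- (sum f {..<n} - s))) (absv (sum f {..<n}))"
      using absv_add_le_max[of "- (sum f {..<n} - s)" "sum f {..<n}"] by simp
    also have "absv (sum f {..<n}) \<le> B"
      using assms by (intro absv_sum_le) auto
    finally show ?thesis by (simp only: absv_minus)
  qed
  then have "absv s \<le> absv (sum f {..<n} - s)" for n
    using \<open>\<not> absv s \<le> B\<close> by (metis le_max_iff_disj)
  moreover have "(\<lambda>n. absv (sum f {..<n} - s)) \<longlonglongrightarrow> 0"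
    using assms(1) by (simp add: sums_iff_absv)
  ultimately have "absv s \<le> 0"
    by (intro LIMSEQ_le_const) auto
  then show False using \<open>\<not> absv s \<le> B\<close> \<open>0 \<le> B\<close> by linarith
qed

text \<open>At \<open>z = T\<^bsup>-k\<^esup>\<close> with \<open>k\<close> large the first non-zero term dominates all later ones.\<close>

lemma q_series_sums_0_imp_0:
  fixes \<gamma> :: "nat \<Rightarrow> 'a"
  assumes "\<And>z. (\<lambda>n. \<gamma> n * z ^ (CARD('k) ^ n)) sums 0"
  shows "\<gamma> n = 0"
proof (induction n rule: less_induct)
  case (less m)
  let ?q = "CARD('k)"
  have q: "1 < ?q" by (rule card_field_gt_1)
  \<comment> \<open>Convergence at \<open>z = 1\<close> bounds all coefficients at once.\<close>
  have "convergent (\<lambda>n. absv (\<gamma> n))"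
    using sums_imp_absv_tendsto_0[OF assms[of 1]] by (auto simp: convergent_def)
  then obtain M where M: "0 \<le> M" "\<And>n. absv (\<gamma> n) \<le> M"
    using convergent_imp_Bseq Bseq_def by (metis absv_nonneg less_imp_le real_norm_def abs_of_nonneg)
  have bound: "absv (\<gamma> m) \<le> M * (1 / 2) ^ k" for k
  proof -
    define z where "z = inverse T ^ k"
    define t where "t = absv z"
    have "T \<noteq> 0" using absv_T q by force
    then have "absv (inverse T) * real ?q = 1"
      using absv_mult[of "inverse T" T] absv_power[of 1 0] by (simp add: absv_T)
    then have "absv (inverse T) = 1 / real ?q" using q by (simp add: field_simps)
    moreover have "1 / real ?q \<le> 1 / 2" using q by (intro divide_left_mono) auto
    ultimately have t: "0 < t" "t \<le> (1 / 2) ^ k" "t \<le> 1"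
      using q unfolding t_def z_def absv_power
      by (auto intro: power_mono power_le_one)
    \<comment> \<open>Subtracting the series from its term of index \<open>m\<close> cancels that
      term; the earlier ones vanish by induction, and the later ones are at most
      \<open>M * t ^ (?q ^ Suc m)\<close>.\<close>
    have "(\<lambda>n. (if n = m then \<gamma> m * z ^ (?q ^ m) else 0) - \<gamma> n * z ^ (?q ^ n))
        sums (\<gamma> m * z ^ (?q ^ m) - 0)"
      by (intro sums_diff_absv sums_single assms)
    then have "absv (\<gamma> m * z ^ (?q ^ m) - 0) \<le> M * t ^ (?q ^ Suc m)"
    proof (rule absv_suminf_le)
      show "0 \<le> M * t ^ (?q ^ Suc m)" using M t by simp
      show "absv ((if n = m then \<gamma> m * z ^ (?q ^ m) else 0) - \<gamma> n * z ^ (?q ^ n)) \<le>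
          M * t ^ (?q ^ Suc m)" for n
      proof (cases "m < n")
        case True
        then have "t ^ (?q ^ n) \<le> t ^ (?q ^ Suc m)"
          using t q by (intro power_decreasing power_increasing) auto
        then have "absv (\<gamma> n) * t ^ (?q ^ n) \<le> M * t ^ (?q ^ Suc m)"
          using M t by (intro mult_mono) auto
        then show ?thesis using True by (simp add: absv_mult absv_power t_def)
      next
        case False
        then show ?thesis using less M t by (cases "n = m") auto
      qed
    qed
    \<comment> \<open>Since \<open>?q ^ Suc m\<close> exceeds \<open>?q ^ m\<close>, a factor
      \<open>t\<close> remains after cancelling \<open>t ^ (?q ^ m)\<close>, and it is at most
      \<open>(1 / 2) ^ k\<close>.\<close>
    also have "\<dots> \<le> M * t ^ (Suc (?q ^ m))"
      using t M q by (intro mult_left_mono power_decreasing) (auto simp: Suc_le_eq)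
    finally have "absv (\<gamma> m) * t ^ (?q ^ m) \<le> (M * t) * t ^ (?q ^ m)"
      by (simp add: absv_mult absv_power t_def mult_ac)
    then have "absv (\<gamma> m) \<le> M * t"
      using t by (simp add: mult_le_cancel_right)
    also have "\<dots> \<le> M * (1 / 2) ^ k"
      using t M by (intro mult_left_mono)
    finally show ?thesis .
  qed
  have "(\<lambda>k. M * (1 / 2) ^ k) \<longlonglongrightarrow> M * 0"
    by (intro tendsto_intros LIMSEQ_power_zero) simp
  then have "absv (\<gamma> m) \<le> M * 0"
    using bound by (intro LIMSEQ_le_const) auto
  then show ?case using absv_nonneg[of "\<gamma> m"] by (simp del: absv_nonneg)
qed

section \<open>The functional equation in terms of coefficients\<close>

lemma twisted_coeff_sums:
  fixes A \<beta> :: "nat \<Rightarrow> 'a"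
  assumes "(\<lambda>n. \<beta> n * z ^ (CARD('k) ^ n)) sums s"
  shows "(\<lambda>n. twisted_coeff CARD('k) r A \<beta> n * z ^ (CARD('k) ^ n)) sums
    (\<Sum>i\<le>r. A i * s ^ (CARD('k) ^ i))"
proof -
  let ?q = "CARD('k)"
  have "(\<lambda>n. if i \<le> n then A i * \<beta> (n - i) ^ (?q ^ i) * z ^ (?q ^ n) else 0)
      sums (A i * s ^ (?q ^ i))" for i
  proof -
    have "?q ^ (n - i) * ?q ^ i = ?q ^ n" if "i \<le> n" for n
      using that by (simp flip: power_add)
    then have "(\<lambda>n. if i \<le> n then A i * \<beta> (n - i) ^ (?q ^ i) * z ^ (?q ^ n) else 0) =
        (\<lambda>n. if i \<le> n then A i * (\<beta> (n - i) * z ^ (?q ^ (n - i))) ^ (?q ^ i) else 0)"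
      by (auto simp: fun_eq_iff power_mult_distrib mult.assoc simp flip: power_mult)
    then show ?thesis
      using sums_delay[OF sums_scaled_power[OF assms, of "A i" i], of i] by simp
  qed
  then have "(\<lambda>n. \<Sum>i\<le>r. if i \<le> n then A i * \<beta> (n - i) ^ (?q ^ i) * z ^ (?q ^ n) else 0)
      sums (\<Sum>i\<le>r. A i * s ^ (?q ^ i))"
    by (intro sums_sum_absv) auto
  moreover have "(\<Sum>i\<le>r. if i \<le> n then A i * \<beta> (n - i) ^ (?q ^ i) * z ^ (?q ^ n) else 0) =
      twisted_coeff ?q r A \<beta> n * z ^ (?q ^ n)" for n
    unfolding twisted_coeff_def sum_distrib_right by (intro sum.cong) auto
  ultimately show ?thesis by simp
qed

text \<open>Both sides are sums of series in the powers \<open>z ^ (q ^ n)\<close>, and a series of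
  this form with sum 0 everywhere has zero coefficients.\<close>

lemma functional_equation_iff:
  fixes A \<beta> :: "nat \<Rightarrow> 'a"
  assumes "\<And>z. summable (\<lambda>n. \<beta> n * z ^ (CARD('k) ^ n))"
  defines "e \<equiv> \<lambda>z. \<Sum>n. \<beta> n * z ^ (CARD('k) ^ n)"
  shows "(\<forall>z. e (T * z) = (\<Sum>i\<le>r. A i * e z ^ (CARD('k) ^ i))) \<longleftrightarrow>
    (\<forall>n. \<beta> n * T ^ (CARD('k) ^ n) = twisted_coeff CARD('k) r A \<beta> n)"
proof -
  let ?q = "CARD('k)"
  have e: "(\<lambda>n. \<beta> n * z ^ (?q ^ n)) sums e z" for z
    unfolding e_def by (rule summable_sums[OF assms(1)])
  have lhs: "(\<lambda>n. (\<beta> n * T ^ (?q ^ n)) * z ^ (?q ^ n)) sums e (T * z)" for z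
    using e[of "T * z"] by (simp add: power_mult_distrib mult.assoc)
  have rhs: "(\<lambda>n. twisted_coeff ?q r A \<beta> n * z ^ (?q ^ n)) sums (\<Sum>i\<le>r. A i * e z ^ (?q ^ i))" for z
    by (rule twisted_coeff_sums[OF e])
  show ?thesis
  proof
    assume eq: "\<forall>z. e (T * z) = (\<Sum>i\<le>r. A i * e z ^ (?q ^ i))"
    have "(\<lambda>n. (\<beta> n * T ^ (?q ^ n) - twisted_coeff ?q r A \<beta> n) * z ^ (?q ^ n)) sums 0" for z
      using sums_diff_absv[OF lhs[of z] rhs[of z]] eq by (simp add: left_diff_distrib)
    then have "\<beta> n * T ^ (?q ^ n) - twisted_coeff ?q r A \<beta> n = 0" for n
      by (rule q_series_sums_0_imp_0)
    then show "\<forall>n. \<beta> n * T ^ (?q ^ n) = twisted_coeff ?q r A \<beta> n" by simp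
  next
    assume "\<forall>n. \<beta> n * T ^ (?q ^ n) = twisted_coeff ?q r A \<beta> n"
    then have "(\<lambda>n. twisted_coeff ?q r A \<beta> n * z ^ (?q ^ n)) sums e (T * z)" for z
      using lhs[of z] by simp
    then show "\<forall>z. e (T * z) = (\<Sum>i\<le>r. A i * e z ^ (?q ^ i))"
      using rhs sums_unique2 by blast
  qed
qed

text \<open>The recursion and the lower bound for the bracket together provide the growth hypothesis
  of \<open>doubly_exponential_decay\<close>.\<close>

lemma summable_if_twisted_coeff:
  fixes A \<beta> :: "nat \<Rightarrow> 'a"
  assumes "A 0 = T" "1 \<le> r"
    and \<beta>: "\<And>n. \<beta> n * T ^ (CARD('k) ^ n) = twisted_coeff CARD('k) r A \<beta> n"
  shows "summable (\<lambda>n. \<beta> n * z ^ (CARD('k) ^ n))"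
proof (rule summable_if_absv_tendsto_0)
  let ?q = "CARD('k)"
  define C where "C = (\<Sum>i\<le>r. absv (A i))"
  have C: "0 \<le> C" "\<And>i. i \<le> r \<Longrightarrow> absv (A i) \<le> C"
    unfolding C_def by (auto intro: sum_nonneg member_le_sum)
  have "(\<lambda>n. absv (\<beta> n) * absv z ^ (?q ^ n)) \<longlonglongrightarrow> 0"
  proof (rule doubly_exponential_decay[where C = C and r = r])
    show "2 \<le> ?q" using card_field_gt_1[where 'k = 'k] by simp
    fix n :: nat assume n: "1 \<le> n"
    have "\<beta> n * bracket ?q T n = (\<Sum>i=1..min r n. A i * \<beta> (n - i) ^ (?q ^ i))"
      using \<beta> twisted_coeff_eq[of A T, OF \<open>A 0 = T\<close>] by blast
    moreover have "{1..min r n} \<noteq> {}" using n \<open>1 \<le> r\<close> by simp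
    note absv_sum_le_some[OF _ this, of "\<lambda>i. A i * \<beta> (n - i) ^ (?q ^ i)"]
    ultimately obtain i where i: "i \<in> {1..min r n}"
      "absv (\<beta> n * bracket ?q T n) \<le> absv (A i * \<beta> (n - i) ^ (?q ^ i))"
      by (metis finite_atLeastAtMost)
    have "absv (\<beta> n) * real ?q ^ (?q ^ n) \<le> absv (\<beta> n) * absv (bracket ?q T n)"
      using absv_power_T_le_bracket[OF n] by (intro mult_left_mono) auto
    also have "\<dots> \<le> absv (A i) * absv (\<beta> (n - i)) ^ (?q ^ i)"
      using i(2) by (simp add: absv_mult absv_power)
    also have "\<dots> \<le> C * absv (\<beta> (n - i)) ^ (?q ^ i)"
      using C i(1) by (intro mult_right_mono) auto
    finally show "\<exists>i\<in>{1..min r n}. absv (\<beta> n) * real ?q ^ (?q ^ n) \<le>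
        C * absv (\<beta> (n - i)) ^ (?q ^ i)"
      using i(1) by blast
  qed (use C in auto)
  then show "(\<lambda>n. absv (\<beta> n * z ^ (?q ^ n))) \<longlonglongrightarrow> 0"
    by (simp add: absv_mult absv_power)
qed

end

theorem theorem3p1:
  fixes \<iota> :: "'k::{field,finite} \<Rightarrow> 'a::{field,complete_space}"
    and T :: 'a and v :: "'a \<Rightarrow> ereal"
    and r :: nat and \<phi> :: "'k poly \<Rightarrow> 'a poly"
    and q :: nat and A \<alpha> :: "nat \<Rightarrow> 'a"
  assumes "drinfeld_module \<iota> T v r \<phi>"
    and "q = CARD('k)"
    and "\<phi> [:0, 1:] = (\<Sum>i\<le>r. monom (A i) i)"
    and "\<And>n. \<alpha> n = (\<Sum>S\<in>shadowed_partitions r n.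
                    tuple_power q r A S / D_prod q T n (\<Union>i\<in>{1..r}. S i))"
  shows
    \<comment> \<open>convergence everywhere\<close>
    "(\<forall>z. summable (\<lambda>n. \<alpha> n * z ^ (q ^ n))) \<and>
    \<comment> \<open>the functional equation, for the sum of the series and for the formal series\<close>
     \<alpha> 0 = 1 \<and>
     (\<forall>z. (\<Sum>n. \<alpha> n * (T * z) ^ (q ^ n)) =
          twisted_eval q (\<phi> [:0, 1:]) (\<Sum>n. \<alpha> n * z ^ (q ^ n))) \<and>
     fps_compose (q_series q \<alpha>) (fps_const T * fps_X) =
       twisted_eval_fps q (\<phi> [:0, 1:]) (q_series q \<alpha>) \<and>
    \<comment> \<open>uniqueness, among everywhere convergent series and among formal series\<close>
     (\<forall>\<beta>. \<beta> 0 = 1 \<longrightarrow>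
          (\<forall>z. summable (\<lambda>n. \<beta> n * z ^ (q ^ n))) \<longrightarrow>
          (\<forall>z. (\<Sum>n. \<beta> n * (T * z) ^ (q ^ n)) =
               twisted_eval q (\<phi> [:0, 1:]) (\<Sum>n. \<beta> n * z ^ (q ^ n))) \<longrightarrow>
          \<beta> = \<alpha>) \<and>
     (\<forall>\<beta>. \<beta> 0 = 1 \<longrightarrow>
          fps_compose (q_series q \<beta>) (fps_const T * fps_X) =
            twisted_eval_fps q (\<phi> [:0, 1:]) (q_series q \<beta>) \<longrightarrow>
          \<beta> = \<alpha>) \<and>
    \<comment> \<open>the exponential function of the Drinfeld module\<close>
     is_exponential \<iota> T \<phi> (\<lambda>z. \<Sum>n. \<alpha> n * z ^ (q ^ n)) \<and>
     exponential \<iota> T \<phi> = (\<lambda>z. \<Sum>n. \<alpha> n * z ^ (q ^ n))"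
proof -
  interpret drinfeld_module \<iota> T v r \<phi> by (rule assms(1))
  note q = assms(2)
  have q2: "2 \<le> q" using card_field_gt_1[where 'k = 'k] by (simp add: q)
  have coeff: "coeff (\<phi> [:0, 1:]) i = (if i \<le> r then A i else 0)" for i
    unfolding assms(3) by (simp add: coeff_sum)
  have A0: "A 0 = T" using phi_T_coeff_0 coeff[of 0] by simp
  have eval: "twisted_eval q (\<phi> [:0, 1:]) x = (\<Sum>i\<le>r. A i * x ^ (q ^ i))" for x
    unfolding twisted_eval_def phi_T_degree by (intro sum.cong) (auto simp: coeff)
  have eval_fps: "twisted_eval_fps q (\<phi> [:0, 1:]) (q_series q \<beta>) =
      q_series q (twisted_coeff q r A \<beta>)" for \<beta>
  proof -
    have "twisted_eval_fps q (\<phi> [:0, 1:]) (q_series q \<beta>) =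
        (\<Sum>i\<le>r. fps_const (A i) * q_series q \<beta> ^ (q ^ i))"
      unfolding twisted_eval_fps_def phi_T_degree by (intro sum.cong) (auto simp: coeff)
    also have "\<dots> = q_series q (twisted_coeff q r A \<beta>)"
      using q_series_twisted_coeff[OF q2] fps_power_card_add unfolding q by blast
    finally show ?thesis .
  qed
  \<comment> \<open>The formal and the analytic functional equation amount to the same coefficient
    identity, so existence and uniqueness are settled once, on coefficients.\<close>
  have formal: "fps_compose (q_series q \<beta>) (fps_const T * fps_X) =
      twisted_eval_fps q (\<phi> [:0, 1:]) (q_series q \<beta>) \<longleftrightarrow>
      (\<forall>n. \<beta> n * T ^ (q ^ n) = twisted_coeff q r A \<beta> n)" for \<beta>
    unfolding eval_fps q_series_compose_linear[OF q2] q_series_inject[OF q2] by (rule fun_eq_iff)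
  have analytic: "(\<forall>z. (\<Sum>n. \<beta> n * (T * z) ^ (q ^ n)) =
        twisted_eval q (\<phi> [:0, 1:]) (\<Sum>n. \<beta> n * z ^ (q ^ n))) \<longleftrightarrow>
      (\<forall>n. \<beta> n * T ^ (q ^ n) = twisted_coeff q r A \<beta> n)"
    if "\<forall>z. summable (\<lambda>n. \<beta> n * z ^ (q ^ n))" for \<beta>
    unfolding eval using functional_equation_iff[where r = r and A = A] that unfolding q by blast
  have \<alpha>: "\<alpha> = partition_coeff q r A T"
    unfolding partition_coeff_def fun_eq_iff assms(4) by blast
  have \<alpha>0: "\<alpha> 0 = 1" by (simp add: \<alpha> partition_coeff_0)
  have rec: "\<alpha> n * T ^ (q ^ n) = twisted_coeff q r A \<alpha> n" for n
  proof (cases "n = 0")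
    \<comment> \<open>The bracket is 0 at \<open>n = 0\<close>, so this index is checked directly:
      both sides equal \<open>T\<close>.\<close>
    case True
    then show ?thesis by (simp add: twisted_coeff_def A0 \<alpha>0)
  next
    case False
    then show ?thesis
      using partition_coeff_rec[OF _ power_card_add, of n r A T] bracket_nonzero[of n]
      unfolding twisted_coeff_eq[of A T, OF A0] \<alpha> q
      by (simp add: zero_less_card_finite)
  qed
  have unique: "\<beta> = \<alpha>"
    if "\<beta> 0 = 1" "\<forall>n. \<beta> n * T ^ (q ^ n) = twisted_coeff q r A \<beta> n" for \<beta>
    using twisted_coeff_unique[where \<gamma> = \<alpha> and q = q and A = A, OF A0 _ _ _ rec] bracket_nonzero that \<alpha>0 unfolding q by simp
  have summable: "\<forall>z. summable (\<lambda>n. \<alpha> n * z ^ (q ^ n))"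
    using summable_if_twisted_coeff[OF A0 rank_pos rec[unfolded q]] unfolding q by blast
  define e where "e = (\<lambda>z. \<Sum>n. \<alpha> n * z ^ (q ^ n))"
  have e: "(\<lambda>n. \<alpha> n * z ^ (q ^ n)) sums e z" for z
    unfolding e_def using summable by (simp add: summable_sums)
  have functional: "\<forall>z. e (T * z) = twisted_eval q (\<phi> [:0, 1:]) (e z)"
    unfolding e_def using analytic[OF summable] rec by blast
  \<comment> \<open>Termwise, \<open>(x + y) ^ (q ^ n)\<close> splits and
    \<open>\<iota> c ^ (q ^ n) = \<iota> c\<close>; uniqueness of limits then gives linearity of
    \<open>e\<close> over the constants.\<close>
  have "e (x + y) = e x + e y" for x y
    using sums_unique2[OF e[of "x + y"]] sums_add_absv[OF e[of x] e[of y]]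
    by (simp add: q power_card_power_add distrib_left)
  moreover have "e (\<iota> c * x) = \<iota> c * e x" for c x
    using sums_unique2[OF e[of "\<iota> c * x"]] sums_mult_absv[OF e[of x], of "\<iota> c"]
    by (simp add: q power_mult_distrib const_power_card mult_ac)
  ultimately have is_exp: "is_exponential \<iota> T \<phi> e"
    unfolding is_exponential_def using e functional \<alpha>0 unfolding q by blast
  \<comment> \<open>The coefficients of any exponential obey the same identity, hence equal
    \<open>\<alpha>\<close>; this is what makes the definite description in
    \<open>exponential\<close> meaningful.\<close>
  have exp_unique: "e' = e" if "is_exponential \<iota> T \<phi> e'" for e'
  proof -
    have "\<exists>a. a 0 = 1 \<and> (\<forall>z. (\<lambda>n. a n * z ^ (q ^ n)) sums e' z)"
      and fe: "\<forall>z. e' (T * z) = twisted_eval q (\<phi> [:0, 1:]) (e' z)"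
      using that unfolding is_exponential_def q by simp_all
    then obtain a where a: "a 0 = 1" "\<And>z. (\<lambda>n. a n * z ^ (q ^ n)) sums e' z"
      by blast
    have e': "e' z = (\<Sum>n. a n * z ^ (q ^ n))" for z
      using a(2) by (rule sums_unique)
    have "\<forall>z. summable (\<lambda>n. a n * z ^ (q ^ n))" using a(2) sums_summable by blast
    then have "a = \<alpha>" using unique a(1) analytic fe unfolding e' by blast
    then show ?thesis by (simp add: fun_eq_iff e' e_def)
  qed
  have "exponential \<iota> T \<phi> = e"
    unfolding exponential_def using is_exp exp_unique by (rule the_equality)
  then show ?thesis
    using summable \<alpha>0 functional is_exp analytic formal unique rec unfolding e_def by blast
qed

end
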